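(* There is an open set $H_\beta\subset\mathbb{C}$, which is the union of $\mathbb{C}-M_{\beta,0}$ and a neighbourhood of the set of all simple centres, such that for every $c_0\in H_\beta$ there are an open set $U\ni c_0$ and a normal branched holomorphic motion $\mathbf{h}:U\times J_{c_0}\to\mathbb{C}$ with base point $c_0$ such that $\mathbf{h}_c(J_{c_0})=J_c$ for every $c\in U$.
   Context: Fix integers $p>q\ge 1$, $\beta=p/q$. For $c\in\mathbb{C}$, $\mathbf{f}_c(z)=\{w:(w-c)^q=z^p\}$ for $z\in\mathbb{C}$. A forward orbit is a sequence with $z_{i+1}\in\mathbf{f}_c(z_i)$; a cycle is a periodic forward orbit. A branch of $\mathbf{f}_c$ is a holomorphic $\varphi$ with $(\varphi(z)-c)^q=z^p$ on its domain. A cycle $(z_i)$ of period $n$ not containing $0$ is repelling if its multiplier $\lambda=\prod_{i=0}^{n-1}\varphi_i'(z_i)$ ($\varphi_i$ a branch with $\varphi_i(z_i)=z_{i+1}$) satisfies $|\lambda|>1$. The Julia set $J_c$ is the closure of the union of all repelling cycles. $K_c$ is the set of points of $\mathbb{C}$ having at least one bounded forward orbit under $\mathbf{f}_c$, and $M_{\beta,0}=\{c\in\mathbb{C}:0\in K_c\}$. A parameter $c$ is a simple centre if $0$ has only one bounded forward orbit under $\mathbf{f}_c$ and this orbit is a cycle. Branched holomorphic motion: let $\Lambda,U$ be nonempty subsets of $\mathbb{C}$ with $U$ open. A multifunction $\mathbf{h}:U\times\Lambda\to\mathbb{C}$ (assigning to each $(c,z)$ a nonempty set $\mathbf{h}_c(z)\subset\mathbb{C}$)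 is a branched holomorphic motion with base point $a\in U$ if (i) $\mathbf{h}_a(z)=\{z\}$ for every $z\in\Lambda$; and (ii) $\bigcup_{z\in\Lambda}\{(c,w):c\in U,\ w\in\mathbf{h}_c(z)\}=\bigcup_{f\in\mathcal{F}}G_f$, where $\mathcal{F}$ is a family of holomorphic functions $f:U\to\mathbb{C}$ and $G_f$ is the graph of $f$. It is normal if $\mathcal{F}$ is a normal family. We write $\mathbf{h}_c(\Lambda)=\bigcup_{z\in\Lambda}\mathbf{h}_c(z)$. *)

theory Defs
  imports "HOL-Complex_Analysis.Complex_Analysis"
begin

text \<open>
  The unicritical correspondences \<open>(w - c)\<^sup>q = z\<^sup>p\<close>. The integers \<open>p > q \<ge> 1\<close> need not be
  coprime, so all notions depend on the pair \<open>(p, q)\<close> and not only on \<open>\<beta> = p/q\<close>.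
\<close>

definition corr :: "nat \<Rightarrow> nat \<Rightarrow> complex \<Rightarrow> complex \<Rightarrow> complex set" where
  "corr p q c z = {w. (w - c) ^ q = z ^ p}"

definition forward_orbit :: "nat \<Rightarrow> nat \<Rightarrow> complex \<Rightarrow> (nat \<Rightarrow> complex) \<Rightarrow> bool" where
  "forward_orbit p q c z \<longleftrightarrow> (\<forall>i. z (Suc i) \<in> corr p q c (z i))"

text \<open>
  \<open>n\<close> is a period, not necessarily the least one; passing to a multiple of the period replaces
  the multiplier by a power of itself, so this does not affect which cycles are repelling.
\<close>

definition cycle_of_period ::
    "nat \<Rightarrow> nat \<Rightarrow> complex \<Rightarrow> nat \<Rightarrow> (nat \<Rightarrow> complex) \<Rightarrow> bool" where
  "cycle_of_period p q c n z \<longleftrightarrow>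
     forward_orbit p q c z \<and> n \<ge> 1 \<and> (\<forall>i. z (i + n) = z i)"

definition is_cycle :: "nat \<Rightarrow> nat \<Rightarrow> complex \<Rightarrow> (nat \<Rightarrow> complex) \<Rightarrow> bool" where
  "is_cycle p q c z \<longleftrightarrow> (\<exists>n. cycle_of_period p q c n z)"

definition is_branch ::
    "nat \<Rightarrow> nat \<Rightarrow> complex \<Rightarrow> complex set \<Rightarrow> (complex \<Rightarrow> complex) \<Rightarrow> bool" where
  "is_branch p q c D \<phi> \<longleftrightarrow>
     open D \<and> \<phi> holomorphic_on D \<and> (\<forall>z\<in>D. (\<phi> z - c) ^ q = z ^ p)"

text \<open>
  The multiplier is a relation because the branches have to be chosen. If the cycle avoids \<open>0\<close>,
  the branch through \<open>(z i, z (Suc i))\<close> exists and its germ is unique, so there is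
  exactly one multiplier for each period \<open>n\<close>.
\<close>

definition has_multiplier ::
    "nat \<Rightarrow> nat \<Rightarrow> complex \<Rightarrow> nat \<Rightarrow> (nat \<Rightarrow> complex) \<Rightarrow> complex \<Rightarrow> bool" where
  "has_multiplier p q c n z m \<longleftrightarrow>
     (\<exists>\<phi> :: nat \<Rightarrow> complex \<Rightarrow> complex.
        (\<forall>i<n. \<exists>D. is_branch p q c D (\<phi> i) \<and> z i \<in> D \<and> \<phi> i (z i) = z (Suc i)) \<and>
        m = (\<Prod>i<n. deriv (\<phi> i) (z i)))"

definition repelling_cycle :: "nat \<Rightarrow> nat \<Rightarrow> complex \<Rightarrow> (nat \<Rightarrow> complex) \<Rightarrow> bool" where
  "repelling_cycle p q c z \<longleftrightarrow>
     (\<exists>n m. cycle_of_period p q c n z \<and> 0 \<notin> range z \<and> has_multiplier p q c n z m \<and> norm m > 1)"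

definition julia :: "nat \<Rightarrow> nat \<Rightarrow> complex \<Rightarrow> complex set" where
  "julia p q c = closure (\<Union>z\<in>{z. repelling_cycle p q c z}. range z)"

definition bounded_forward_orbit_from ::
    "nat \<Rightarrow> nat \<Rightarrow> complex \<Rightarrow> complex \<Rightarrow> (nat \<Rightarrow> complex) \<Rightarrow> bool" where
  "bounded_forward_orbit_from p q c x z \<longleftrightarrow>
     forward_orbit p q c z \<and> z 0 = x \<and> bounded (range z)"

definition filled_julia :: "nat \<Rightarrow> nat \<Rightarrow> complex \<Rightarrow> complex set" where
  "filled_julia p q c = {x. \<exists>z. bounded_forward_orbit_from p q c x z}"

definition M_set :: "nat \<Rightarrow> nat \<Rightarrow> complex set" where
  "M_set p q = {c. 0 \<in> filled_julia p q c}"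

definition simple_centre :: "nat \<Rightarrow> nat \<Rightarrow> complex \<Rightarrow> bool" where
  "simple_centre p q c \<longleftrightarrow>
     (\<exists>!z. bounded_forward_orbit_from p q c 0 z) \<and>
     (\<forall>z. bounded_forward_orbit_from p q c 0 z \<longrightarrow> is_cycle p q c z)"

text \<open>
  Normality is relative sequential compactness in the space of holomorphic functions \<open>U \<rightarrow> \<complex>\<close>:
  the constant limit \<open>\<infinity>\<close> is not allowed.
\<close>

definition normal_family :: "complex set \<Rightarrow> (complex \<Rightarrow> complex) set \<Rightarrow> bool" where
  "normal_family U \<F> \<longleftrightarrow>
     (\<forall>f\<in>\<F>. f holomorphic_on U) \<and>
     (\<forall>s :: nat \<Rightarrow> complex \<Rightarrow> complex. range s \<subseteq> \<F> \<longrightarrow>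
        (\<exists>g r. g holomorphic_on U \<and> strict_mono (r :: nat \<Rightarrow> nat) \<and>
           (\<forall>K. compact K \<and> K \<subseteq> U \<longrightarrow> uniform_limit K (s \<circ> r) g sequentially)))"

text \<open>
  A multifunction on \<open>U \<times> \<Lambda>\<close> is a total set-valued function \<open>h\<close> of which only the values
  \<open>h c z\<close> with \<open>c \<in> U\<close>, \<open>z \<in> \<Lambda>\<close> matter. The family \<open>\<F>\<close> is a parameter because it is not
  determined by \<open>h\<close>.
\<close>

definition branched_holomorphic_motion_via ::
    "(complex \<Rightarrow> complex) set \<Rightarrow> complex set \<Rightarrow> complex set \<Rightarrow> complex \<Rightarrow>
     (complex \<Rightarrow> complex \<Rightarrow> complex set) \<Rightarrow> bool" where
  "branched_holomorphic_motion_via \<F> U \<Lambda> a h \<longleftrightarrow>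
     open U \<and> U \<noteq> {} \<and> \<Lambda> \<noteq> {} \<and> a \<in> U \<and>
     (\<forall>c\<in>U. \<forall>z\<in>\<Lambda>. h c z \<noteq> {}) \<and>
     (\<forall>z\<in>\<Lambda>. h a z = {z}) \<and>
     (\<forall>f\<in>\<F>. f holomorphic_on U) \<and>
     (\<Union>z\<in>\<Lambda>. {(c, w). c \<in> U \<and> w \<in> h c z}) = (\<Union>f\<in>\<F>. {(c, f c) | c. c \<in> U})"

definition normal_branched_holomorphic_motion ::
    "complex set \<Rightarrow> complex set \<Rightarrow> complex \<Rightarrow> (complex \<Rightarrow> complex \<Rightarrow> complex set) \<Rightarrow> bool" where
  "normal_branched_holomorphic_motion U \<Lambda> a h \<longleftrightarrow>
     (\<exists>\<F>. branched_holomorphic_motion_via \<F> U \<Lambda> a h \<and> normal_family U \<F>)"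

end

theory Submission
  imports Defs "HOL-Computational_Algebra.Fundamental_Theorem_Algebra"
begin

text \<open>
  Over a suitable disc \<open>U\<close> of parameters the Julia set moves with its repelling cycles.
  Suppose that every repelling periodic point of every parameter in \<open>U\<close> lies on the graph of a
  holomorphic function on \<open>U\<close> whose values are again repelling periodic points, all in one
  bounded set. By Montel's theorem these functions form a normal family, and their limits are
  functions \<open>f\<close> with \<open>f c \<in> J\<^sub>c\<close> whose graphs pass through every point of every
  \<open>J\<^sub>c\<close>. Hence the family of \<^emph>\<open>all\<close> holomorphic \<open>f\<close> on \<open>U\<close> with
  \<open>f c \<in> J\<^sub>c\<close> is normal and sweeps out all Julia sets, and \<open>{f c | f b = z}\<close> is a branched
  motion for every base point \<open>b \<in> U\<close> (\<open>julia_branched_motion\<close>). What has to be shown is that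
  repelling cycles persist over a disc whose size does not depend on the cycle.

  Persistence comes from a bounded set \<open>\<Omega>\<close> that omits the critical point \<open>0\<close> and contains the
  \<open>\<epsilon>\<close>-neighbourhood of its preimages under all \<open>f\<^sub>c\<close> with \<open>c \<in> U\<close> (a
  \<open>backward_trap\<close>). As \<open>\<Omega>\<close> then omits the parameters \<open>c \<in> U\<close>, the
  multivalued map \<open>w \<mapsto> (w - c)^(q/p)\<close> is unbranched over \<open>\<Omega>\<close>, so that every holomorphic map from a
  convex domain into \<open>\<Omega>\<close> lifts through it, and the lifts have values in \<open>\<Omega>\<close> again.
  \<^item> Every cycle inside \<open>\<Omega>\<close> is repelling (\<open>cycle_multiplier_gt_one\<close>). This is the
    contraction of the Kobayashi metric: lifting a disc \<open>\<phi>\<close> in \<open>\<Omega>\<close> around the cycle divides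
    \<open>\<phi>'(0)\<close> by the multiplier, and the room \<open>\<epsilon>\<close> makes the contraction strict.
  \<^item> Every cycle inside \<open>\<Omega>\<close> continues holomorphically over all of \<open>U\<close>
    (\<open>cycle_continuation\<close>): the constant function at a point of the cycle is lifted
    backwards infinitely often along the cycle, now with \<open>c\<close> as the variable, and the lifts
    accumulate at a function whose values are periodic points.

  It remains to find a trap near a parameter \<open>a\<close> outside \<open>M\<^bsub>\<beta>,0\<^esub>\<close> or at a simple centre
  (\<open>exists_backward_trap\<close>). In both cases there are a small \<open>\<delta>\<close> and integers
  \<open>1 \<le> n \<le> N\<close> such that every orbit segment of length \<open>N\<close> in the disc of an escape radius \<open>R\<close>
  that starts in the disc of radius \<open>\<delta>\<close> about \<open>0\<close> is back in that disc at time \<open>n\<close>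
  (\<open>return_radius\<close>): outside \<open>M\<^bsub>\<beta>,0\<^esub>\<close> there are no such segments, and at a simple centre they
  follow the superattracting cycle of \<open>0\<close>. The statement survives small errors in \<open>c\<close>, that
  is, it holds for pseudo-orbits. The starting points of pseudo-orbits of length \<open>N\<close> in the
  annulus \<open>\<delta> < |w| < R\<close> form the trap. Repelling cycles stay in this annulus, because a
  cycle that meets the small disc returns to it every \<open>n\<close> steps and picks up a
  derivative of modulus at most \<open>1\<close> each time.
\<close>

section \<open>Derivatives of branches\<close>

text \<open>
  The derivative at \<open>z\<close> of the branch of the correspondence that sends \<open>z \<noteq> 0\<close> to \<open>w\<close>,
  obtained by differentiating \<open>(w - c) ^ q = z ^ p\<close>.
\<close>

definition step_factor :: "nat \<Rightarrow> nat \<Rightarrow> complex \<Rightarrow> complex \<Rightarrow> complex \<Rightarrow> complex" where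
  "step_factor p q c z w = of_nat p * z ^ (p - 1) / (of_nat q * (w - c) ^ (q - 1))"

lemma norm_of_root:
  fixes a z :: complex
  assumes "1 \<le> q" "a ^ q = z ^ p" "z \<noteq> 0"
  shows "norm a = norm z powr (real p / real q)"
proof -
  have "norm a ^ q = norm z ^ p"
    using assms(2) by (metis norm_power)
  moreover have "(norm z powr (real p / real q)) ^ q = norm z ^ p"
    using assms by (simp add: powr_powr flip: powr_realpow)
  ultimately have "norm a ^ q = (norm z powr (real p / real q)) ^ q"
    by simp
  then show ?thesis
    using assms(1) by (auto dest: power_eq_imp_eq_base)
qed

text \<open>
  The modulus of the derivative depends on \<open>z\<close> alone, and for \<open>p > q\<close> it is small near
  \<open>0\<close>. So the size of a multiplier can be read off from the points of the cycle, without
  reference to \<open>c\<close> or to the branches.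
\<close>

lemma norm_step_factor:
  assumes "1 \<le> q" "1 \<le> p" "(w - c) ^ q = z ^ p" "z \<noteq> 0"
  shows "norm (step_factor p q c z w) = real p / real q * norm z powr (real p / real q - 1)"
proof -
  have n: "norm (w - c) = norm z powr (real p / real q)"
    using norm_of_root assms by blast
  have "real (p - 1) - real p / real q * real (q - 1) = real p / real q - 1"
    using assms by (simp add: of_nat_diff field_simps)
  then have "norm z ^ (p - 1) / norm (w - c) ^ (q - 1) = norm z powr (real p / real q - 1)"
    using assms(4) by (simp add: n powr_powr flip: powr_realpow powr_diff)
  then have "real p / real q * (norm z ^ (p - 1) / norm (w - c) ^ (q - 1)) =
      real p / real q * norm z powr (real p / real q - 1)"
    by simp
  then show ?thesis
    by (simp add: step_factor_def norm_divide norm_mult norm_power)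
qed

lemma deriv_of_root_relation:
  assumes f: "f field_differentiable at t" and h: "h field_differentiable at t"
    and rel: "\<forall>\<^sub>F s in nhds t. (f s - c) ^ q = h s ^ p"
    and "1 \<le> q" "h t \<noteq> 0"
  shows "deriv f t = step_factor p q c (h t) (f t) * deriv h t"
proof -
  have eq: "(f t - c) ^ q = h t ^ p"
    using rel eventually_nhds_x_imp_x by blast
  then have nz: "f t - c \<noteq> 0"
    using assms by (metis power_not_zero power_0_left not_one_le_zero)
  have df: "(f has_field_derivative deriv f t) (at t)" 
    and dh: "(h has_field_derivative deriv h t) (at t)"
    using f h by (simp_all add: DERIV_deriv_iff_field_differentiable)
  have d1: "((\<lambda>s. (f s - c) ^ q) has_field_derivative
      of_nat q * deriv f t * (f t - c) ^ (q - 1)) (at t)"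
    by (auto intro!: derivative_eq_intros df)
  have d2: "((\<lambda>s. h s ^ p) has_field_derivative
      of_nat p * deriv h t * h t ^ (p - 1)) (at t)"
    by (auto intro!: derivative_eq_intros dh)
  have d3: "((\<lambda>s. (f s - c) ^ q) has_field_derivative
      of_nat p * deriv h t * h t ^ (p - 1)) (at t)"
    using d2 DERIV_cong_ev [OF refl rel refl] by blast
  have "of_nat q * deriv f t * (f t - c) ^ (q - 1) = of_nat p * deriv h t * h t ^ (p - 1)"
    using DERIV_unique [OF d1 d3] .
  then show ?thesis
    using nz assms(4) by (simp add: step_factor_def field_simps)
qed

lemma deriv_branch:
  assumes "is_branch p q c D \<phi>" "z \<in> D" "z \<noteq> 0" "1 \<le> q"
  shows "deriv \<phi> z = step_factor p q c z (\<phi> z)"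
proof -
  have D: "open D" "\<phi> holomorphic_on D" "\<forall>z\<in>D. (\<phi> z - c) ^ q = z ^ p"
    using assms(1) by (auto simp: is_branch_def)
  have "\<forall>\<^sub>F s in nhds z. (\<phi> s - c) ^ q = id s ^ p"
    using D assms(2) by (auto simp: eventually_nhds)
  then have "deriv \<phi> z = step_factor p q c (id z) (\<phi> z) * deriv id z"
    using assms D by (intro deriv_of_root_relation)
      (auto simp: id_def intro: holomorphic_on_imp_differentiable_at)
  then show ?thesis by (simp add: id_def)
qed

text \<open>
  A nonvanishing holomorphic function on a convex domain has a logarithm, hence all fractional
  powers; the value of the \<open>p\<close>-th root at \<open>t0\<close> can be prescribed. The subtracted
  function \<open>g\<close> serves both for a constant parameter and for the parameter as the variable.
\<close>

lemma root_along_convex: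
  fixes f g :: "complex \<Rightarrow> complex"
  assumes V: "open V" "convex V" "t0 \<in> V"
    and hol: "f holomorphic_on V" "g holomorphic_on V"
    and ne: "\<And>t. t \<in> V \<Longrightarrow> f t \<noteq> g t"
    and z: "(f t0 - g t0) ^ q = z ^ p" and p: "1 \<le> p"
  obtains h where "h holomorphic_on V" "h t0 = z" "\<And>t. t \<in> V \<Longrightarrow> (f t - g t) ^ q = h t ^ p"
proof -
  have "(\<lambda>t. f t - g t) holomorphic_on V"
    using hol by (intro holomorphic_intros)
  then obtain L where L: "L holomorphic_on V" "\<And>t. t \<in> V \<Longrightarrow> exp (L t) = f t - g t"
    using holomorphic_logarithm_exists [OF V(2,1) _ _ V(3), of "\<lambda>t. f t - g t"] ne by auto
  define h where "h t = z * exp (of_nat q / of_nat p * (L t - L t0))" for t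
  have "h t ^ p = (f t - g t) ^ q" if "t \<in> V" for t
  proof -
    have "h t ^ p = z ^ p * exp (of_nat q * (L t - L t0))"
      using p by (simp add: h_def power_mult_distrib exp_of_nat_mult [symmetric])
    also have "\<dots> = z ^ p * (exp (L t) / exp (L t0)) ^ q"
      by (simp add: exp_of_nat_mult exp_diff)
    also have "\<dots> = (f t0 - g t0) ^ q * ((f t - g t) / (f t0 - g t0)) ^ q"
      using L(2) V(3) that z by simp
    also have "\<dots> = (f t - g t) ^ q"
      using ne [OF V(3)] by (simp add: power_divide)
    finally show ?thesis .
  qed
  moreover have "h holomorphic_on V"
    unfolding h_def using L(1) by (intro holomorphic_intros)
  ultimately show ?thesis
    using that [of h] by (simp add: h_def)
qed

lemma branch_exists:
  assumes "(w - c) ^ q = z ^ p" "z \<noteq> 0" "1 \<le> q"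
  obtains D \<phi> where "is_branch p q c D \<phi>" "z \<in> D" "\<phi> z = w"
proof -
  have nz: "t \<noteq> 0" if "t \<in> ball z (norm z)" for t
    using that by (auto simp: dist_norm)
  obtain h where h: "h holomorphic_on ball z (norm z)" "h z = w - c"
      "\<And>t. t \<in> ball z (norm z) \<Longrightarrow> (t - 0) ^ p = h t ^ q"
    by (rule root_along_convex [of "ball z (norm z)" z "\<lambda>t. t" "\<lambda>t. 0" p "w - c" q])
      (use assms nz in \<open>auto simp: holomorphic_on_ident\<close>)
  have "is_branch p q c (ball z (norm z)) (\<lambda>t. h t + c)"
    using h by (auto simp: is_branch_def intro!: holomorphic_intros)
  then show ?thesis
    using that assms(2) h(2) by auto
qed

lemma has_multiplier_iff:
  assumes "forward_orbit p q c z" "0 \<notin> range z" "1 \<le> q"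
  shows "has_multiplier p q c n z m \<longleftrightarrow> m = (\<Prod>i<n. step_factor p q c (z i) (z (Suc i)))"
proof
  assume "has_multiplier p q c n z m"
  then obtain \<phi> where \<phi>: "\<forall>i<n. \<exists>D. is_branch p q c D (\<phi> i) \<and> z i \<in> D \<and> \<phi> i (z i) = z (Suc i)"
     and m: "m = (\<Prod>i<n. deriv (\<phi> i) (z i))"
    by (auto simp: has_multiplier_def)
  have "deriv (\<phi> i) (z i) = step_factor p q c (z i) (z (Suc i))" if "i < n" for i
    using \<phi> that deriv_branch assms(2,3) by (metis rangeI)
  then show "m = (\<Prod>i<n. step_factor p q c (z i) (z (Suc i)))"
    by (simp add: m)
next
  assume m: "m = (\<Prod>i<n. step_factor p q c (z i) (z (Suc i)))"
  have "\<exists>\<phi> D. is_branch p q c D \<phi> \<and> z i \<in> D \<and> \<phi> (z i) = z (Suc i)" for i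
  proof -
    have "(z (Suc i) - c) ^ q = z i ^ p" "z i \<noteq> 0"
      using assms(1,2) by (auto simp: forward_orbit_def corr_def) 
    then show ?thesis
      using branch_exists [of "z (Suc i)" c q "z i" p] assms(3) by blast
  qed
  then obtain \<phi> D where \<phi>: "\<And>i. is_branch p q c (D i) (\<phi> i) \<and> z i \<in> D i \<and> \<phi> i (z i) = z (Suc i)"
    by metis
  then have "deriv (\<phi> i) (z i) = step_factor p q c (z i) (z (Suc i))" for i
    using deriv_branch assms(2,3) by (metis rangeI)
  then show "has_multiplier p q c n z m"
    unfolding has_multiplier_def m using \<phi> by (intro exI [of _ \<phi>]) auto
qed

text \<open>
  Away from \<open>0\<close> the choice of branches disappears from the definition of a repelling cycle.
\<close>

lemma repelling_cycle_iff:
  assumes "1 \<le> q" "1 \<le> p" "0 \<notin> range z"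
  shows "repelling_cycle p q c z \<longleftrightarrow> (\<exists>n. cycle_of_period p q c n z \<and>
      (\<Prod>i<n. real p / real q * norm (z i) powr (real p / real q - 1)) > 1)"
proof -
  have "norm (\<Prod>i<n. step_factor p q c (z i) (z (Suc i))) =
      (\<Prod>i<n. real p / real q * norm (z i) powr (real p / real q - 1))"
    if "forward_orbit p q c z" for n
    unfolding prod_norm [symmetric] using that assms
    by (intro prod.cong refl norm_step_factor) (auto simp: forward_orbit_def corr_def image_iff)
  then show ?thesis
    unfolding repelling_cycle_def using assms has_multiplier_iff
    by (auto simp: cycle_of_period_def)
qed

section \<open>Backward traps and expansion\<close>

text \<open>
  The ball in the last assumption, instead of just \<open>z \<in> \<Omega>\<close>, is what makes the expansion along
  cycles strict and what keeps limits of lifted functions inside \<open>\<Omega>\<close>. The set \<open>\<Omega>\<close> need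
  not be open; it is the same for all parameters in \<open>U\<close>, so that functions of the parameter
  can be lifted.
\<close>

locale backward_trap =
  fixes p q :: nat and U \<Omega> :: "complex set" and \<epsilon> :: real
  assumes q_pos: "1 \<le> q" and q_less_p: "q < p"
    and open_U: "open U" and convex_U: "convex U"
    and bounded_\<Omega>: "bounded \<Omega>" and zero_notin: "0 \<notin> \<Omega>" and \<epsilon>_pos: "0 < \<epsilon>"
    and preimage_ball: "\<lbrakk>c \<in> U; w \<in> \<Omega>; (w - c) ^ q = z ^ p\<rbrakk> \<Longrightarrow> ball z \<epsilon> \<subseteq> \<Omega>"
begin

lemma preimage_mem: "\<lbrakk>c \<in> U; w \<in> \<Omega>; (w - c) ^ q = z ^ p\<rbrakk> \<Longrightarrow> z \<in> \<Omega>"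
  using preimage_ball \<epsilon>_pos centre_in_ball by blast

text \<open>
  The point \<open>0\<close> is a preimage of the parameter \<open>c\<close>, and \<open>\<Omega>\<close> contains its preimages but not
  \<open>0\<close>. So the inverse of the correspondence is unbranched over \<open>\<Omega>\<close>.
\<close>

lemma param_notin:
  assumes "c \<in> U" shows "c \<notin> \<Omega>"
proof
  assume "c \<in> \<Omega>"
  moreover have "(c - c) ^ q = 0 ^ p"
    using q_pos q_less_p by (auto simp: power_0_left)
  ultimately have "0 \<in> \<Omega>"
    using preimage_mem assms by blast
  then show False
    using zero_notin by contradiction
qed

lemma lift_exists:
  assumes V: "open V" "convex V" "t0 \<in> V"
    and f: "f holomorphic_on V" "f ` V \<subseteq> \<Omega>" and g: "g holomorphic_on V" "g ` V \<subseteq> U"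
    and z: "(f t0 - g t0) ^ q = z ^ p"
  obtains h where "h holomorphic_on V" "h t0 = z" "\<And>t. t \<in> V \<Longrightarrow> (f t - g t) ^ q = h t ^ p"
    "\<And>t. t \<in> V \<Longrightarrow> ball (h t) \<epsilon> \<subseteq> \<Omega>"
proof -
  have "f t \<noteq> g t" if "t \<in> V" for t
    using param_notin f(2) g(2) that by (metis image_subset_iff)
  then obtain h where h: "h holomorphic_on V" "h t0 = z" "\<And>t. t \<in> V \<Longrightarrow> (f t - g t) ^ q = h t ^ p"
    using root_along_convex [OF V f(1) g(1) _ z] q_less_p by auto
  moreover have "ball (h t) \<epsilon> \<subseteq> \<Omega>" if "t \<in> V" for t
    using preimage_ball h(3) f(2) g(2) that by (metis image_subset_iff)
  ultimately show ?thesis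
    using that by blast
qed

text \<open>
  Let \<open>S\<close> be the supremum of \<open>|\<phi>'(0)|\<close> over all holomorphic \<open>\<phi>\<close> from the unit disc into
  \<open>\<Omega>\<close> with \<open>\<phi>(0) = z\<^sub>0\<close>; it is finite because \<open>\<Omega>\<close> is bounded (\<open>1/S\<close> is the Kobayashi metric at
  \<open>z\<^sub>0\<close>). Lifting \<open>\<phi>\<close> backwards along the cycle gives a competitor
  \<open>\<psi>\<close> with \<open>\<phi>'(0) = \<mu> \<psi>'(0)\<close>, where \<open>\<mu>\<close> is the multiplier, and the \<open>\<epsilon>\<close>-neighbourhood of
  the image of \<open>\<psi>\<close> is in \<open>\<Omega>\<close>. Hence \<open>\<psi>(t) + \<epsilon>ut\<close> with \<open>|u| = 1\<close> is a competitor as well, and a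
  suitable direction \<open>u\<close> gives \<open>|\<psi>'(0)| + \<epsilon> \<le> S\<close>. Taking the supremum over \<open>\<phi>\<close> yields
  \<open>S \<le> |\<mu>| (S - \<epsilon>)\<close>, so \<open>|\<mu>| > 1\<close>.
\<close>

lemma cycle_multiplier_gt_one:
  assumes c: "c \<in> U" and orb: "forward_orbit p q c z" and n: "1 \<le> n" "z n = z 0"
    and \<Omega>: "range z \<subseteq> \<Omega>"
  shows "1 < norm (\<Prod>i<n. step_factor p q c (z i) (z (Suc i)))"
proof -
  define mu where "mu = (\<Prod>i<n. step_factor p q c (z i) (z (Suc i)))"
  define X where "X = {\<phi>. \<phi> holomorphic_on ball 0 1 \<and> \<phi> ` ball 0 1 \<subseteq> \<Omega> \<and> \<phi> 0 = z 0}"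
  define S where "S = (SUP \<phi>\<in>X. norm (deriv \<phi> 0))"
  have rel: "(z (Suc i) - c) ^ q = z i ^ p" for i
    using orb by (simp add: forward_orbit_def corr_def)
  have z\<Omega>: "z i \<in> \<Omega>" for i
    using \<Omega> by auto
  obtain B where B: "\<And>w. w \<in> \<Omega> \<Longrightarrow> norm w < B"
    using bounded_\<Omega> by (metis bounded_pos_less)
  have "norm (deriv \<phi> 0) \<le> 2 * B" if "\<phi> \<in> X" for \<phi>
  proof -
    have h: "\<phi> holomorphic_on ball 0 1"
      using that by (simp add: X_def)
    have "\<phi> holomorphic_on cball 0 (1/2)"
      by (rule holomorphic_on_subset [OF h]) auto
    moreover have "\<phi> w \<in> ball 0 B" if "w \<in> ball 0 (1/2)" for w
      using that \<open>\<phi> \<in> X\<close> B by (force simp: X_def image_subset_iff)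
    ultimately have "cmod ((deriv ^^ 1) \<phi> 0) \<le> fact 1 * B / (1/2) ^ 1"
      by (intro Cauchy_higher_deriv_bound [where y = 0])
        (auto intro: holomorphic_on_imp_continuous_on holomorphic_on_subset)
    then show ?thesis by simp
  qed
  then have bdd: "bdd_above ((\<lambda>\<phi>. norm (deriv \<phi> 0)) ` X)"
    by (auto simp: bdd_above_def)
  have pull: "\<exists>\<psi>\<in>X. deriv \<phi> 0 = mu * deriv \<psi> 0 \<and> (\<forall>t\<in>ball 0 1. ball (\<psi> t) \<epsilon> \<subseteq> \<Omega>)"
    if "\<phi> \<in> X" for \<phi>
  proof -
    have "\<exists>\<psi>. \<psi> holomorphic_on ball 0 1 \<and> \<psi> ` ball 0 1 \<subseteq> \<Omega> \<and> \<psi> 0 = z i \<and>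
        deriv \<phi> 0 = (\<Prod>j\<in>{i..<n}. step_factor p q c (z j) (z (Suc j))) * deriv \<psi> 0 \<and>
        (i < n \<longrightarrow> (\<forall>t\<in>ball 0 1. ball (\<psi> t) \<epsilon> \<subseteq> \<Omega>))" if "i \<le> n" for i
      using that
    proof (induction i rule: inc_induct)
      case base
      show ?case
        using \<open>\<phi> \<in> X\<close> n(2) by (intro exI [of _ \<phi>]) (auto simp: X_def)
    next
      case (step i)
      then obtain f where f: "f holomorphic_on ball 0 1" "f ` ball 0 1 \<subseteq> \<Omega>" "f 0 = z (Suc i)"
        "deriv \<phi> 0 = (\<Prod>j\<in>{Suc i..<n}. step_factor p q c (z j) (z (Suc j))) * deriv f 0"
        by blast
      obtain h where h: "h holomorphic_on ball 0 1" "h 0 = z i"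
          "\<And>t. t \<in> ball 0 1 \<Longrightarrow> (f t - c) ^ q = h t ^ p" "\<And>t. t \<in> ball 0 1 \<Longrightarrow> ball (h t) \<epsilon> \<subseteq> \<Omega>"
        using lift_exists [of "ball 0 1" 0 f "\<lambda>t. c" "z i"] f(1-3) c rel by auto
      have "\<forall>\<^sub>F s in nhds 0. (f s - c) ^ q = h s ^ p"
        using h(3) unfolding eventually_nhds by (metis centre_in_ball open_ball zero_less_one)
      moreover have "h 0 \<noteq> 0"
        using h(2) z\<Omega> zero_notin by metis
      ultimately have "deriv f 0 = step_factor p q c (h 0) (f 0) * deriv h 0"
        using f(1) h(1) q_pos by (intro deriv_of_root_relation)
          (auto intro: holomorphic_on_imp_differentiable_at)
      moreover have "{i..<n} = insert i {Suc i..<n}"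
        using step by auto
      moreover have "h ` ball 0 1 \<subseteq> \<Omega>"
        using h(4) \<epsilon>_pos by force
      ultimately show ?case
        using h(1,2,4) f(3,4) by (intro exI [of _ h]) (auto simp: algebra_simps)
    qed
    from this [of 0] show ?thesis
      using n(1) by (auto simp: X_def mu_def atLeast0LessThan)
  qed
  have gain: "norm (deriv \<phi> 0) \<le> norm mu * (S - \<epsilon>) \<and> \<epsilon> \<le> S" if "\<phi> \<in> X" for \<phi>
  proof -
    obtain \<psi> where \<psi>: "\<psi> \<in> X" "deriv \<phi> 0 = mu * deriv \<psi> 0" "\<And>t. t \<in> ball 0 1 \<Longrightarrow> ball (\<psi> t) \<epsilon> \<subseteq> \<Omega>"
      using pull [OF \<open>\<phi> \<in> X\<close>] by blast
    define d where "d = deriv \<psi> 0"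
    \<comment> \<open>The direction in which adding \<open>\<epsilon>u\<close> to \<open>d\<close> increases the modulus most.\<close>
    define u where "u = (if d = 0 then 1 else sgn d)"
    have u: "norm u = 1"
      by (simp add: u_def norm_sgn)
    have nu: "norm (d + of_real \<epsilon> * u) = norm d + \<epsilon>"
    proof (cases "d = 0")
      case False
      then have "d + of_real \<epsilon> * u = of_real (norm d + \<epsilon>) * u"
        by (simp add: u_def sgn_eq field_simps)
      then show ?thesis
        using u \<epsilon>_pos by (metis (no_types, opaque_lifting) abs_of_nonneg add_nonneg_nonneg less_imp_le mult.right_neutral norm_ge_zero norm_mult norm_of_real)
    qed (use \<epsilon>_pos in \<open>auto simp: u_def\<close>)
    define g where "g t = \<psi> t + of_real \<epsilon> * u * t" for t
    have hol: "\<psi> holomorphic_on ball 0 1"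
      using \<psi> by (simp add: X_def)
    have "g t \<in> \<Omega>" if "t \<in> ball 0 1" for t
    proof -
      have "g t \<in> ball (\<psi> t) \<epsilon>"
        using that u \<epsilon>_pos by (simp add: g_def dist_norm norm_mult)
      then show ?thesis
        using \<psi>(3) that by blast
    qed
    moreover have "g holomorphic_on ball 0 1"
      unfolding g_def by (intro holomorphic_intros hol)
    ultimately have "g \<in> X"
      using \<psi>(1) by (auto simp: X_def g_def)
    have "(\<psi> has_field_derivative d) (at 0)"
      using hol by (simp add: d_def DERIV_deriv_iff_field_differentiable holomorphic_on_imp_differentiable_at [of _ "ball 0 1"])
    then have "(g has_field_derivative d + of_real \<epsilon> * u) (at 0)"
      unfolding g_def by (auto intro!: derivative_eq_intros)
    then have "deriv g 0 = d + of_real \<epsilon> * u"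
      by (rule DERIV_imp_deriv)
    then have "norm d + \<epsilon> \<le> S"
      using cSUP_upper [OF \<open>g \<in> X\<close> bdd] nu by (simp add: S_def)
    moreover have "norm (deriv \<phi> 0) = norm mu * norm d"
      by (simp add: \<psi>(2) d_def norm_mult)
    moreover have "norm mu * norm d \<le> norm mu * (S - \<epsilon>)"
      using calculation by (intro mult_left_mono) auto
    ultimately show ?thesis
      using norm_ge_zero [of d] by linarith
  qed
  have const: "(\<lambda>t. z 0) \<in> X"
    using z\<Omega> by (auto simp: X_def)
  have "S \<le> norm mu * (S - \<epsilon>)"
    unfolding S_def using gain const by (intro cSUP_least) (auto simp: S_def)
  moreover have "norm mu * (S - \<epsilon>) \<le> S - \<epsilon>" if "norm mu \<le> 1"
    using that gain [OF const] by (intro mult_left_le_one_le) auto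
  ultimately show ?thesis
    using \<epsilon>_pos unfolding mu_def by linarith
qed

lemma cycle_repelling:
  assumes "c \<in> U" "cycle_of_period p q c n z" "range z \<subseteq> \<Omega>"
  shows "repelling_cycle p q c z"
proof -
  have z: "forward_orbit p q c z" "1 \<le> n" "z n = z 0" "0 \<notin> range z"
    using assms zero_notin by (auto simp: cycle_of_period_def) (metis add_0)
  then show ?thesis
    using cycle_multiplier_gt_one [OF assms(1) z(1-3) assms(3)] assms(2)
      has_multiplier_iff [OF z(1,4) q_pos] unfolding repelling_cycle_def by blast
qed

end

section \<open>Holomorphic continuation of cycles\<close>

lemma periodic_add_mult:
  fixes f :: "nat \<Rightarrow> 'a"
  assumes "\<And>i. f (i + n) = f i"
  shows "f (i + k * n) = f i"
  by (induction k) (use assms in \<open>auto simp: algebra_simps\<close>, metis add.assoc add.commute)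

lemma prod_periodic_shift:
  fixes f :: "nat \<Rightarrow> 'a::comm_monoid_mult"
  assumes per: "\<And>i. f (i + n) = f i"
  shows "(\<Prod>i<n. f (m + i)) = (\<Prod>i<n. f i)"
proof (induction m)
  case (Suc m)
  have "(\<Prod>i<n. f (Suc m + i)) = (\<Prod>i<n. f (m + i))"
  proof (cases n)
    case (Suc k)
    have "(\<Prod>i<Suc k. f (m + i)) = f m * (\<Prod>i<k. f (Suc m + i))"
      by (subst prod.lessThan_Suc_shift) simp
    moreover have "f (Suc m + k) = f m"
      using per [of m] Suc by simp
    ultimately show ?thesis
      by (simp add: Suc mult.commute)
  qed simp
  then show ?case
    using Suc by simp
qed simp

text \<open>
  Stepping by \<open>n - 1\<close> runs through a sequence of period \<open>n\<close> backwards. This converts cycles of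
  the correspondence into cycles of its inverse and back.
\<close>

lemma reverse_periodic_relation:
  fixes x :: "nat \<Rightarrow> 'a"
  assumes per: "\<And>i. x (i + n) = x i" and n: "1 \<le> n" and rel: "\<And>i. P (x (Suc i)) (x i)"
  defines "y \<equiv> \<lambda>i. x (i * (n - 1))"
  shows "P (y i) (y (Suc i))" "y (i + n) = y i" "y 0 = x 0" "j \<le> n \<Longrightarrow> y j = x (n - j)"
proof -
  have "Suc (Suc i * (n - 1)) = i * (n - 1) + n"
    using n by (cases n) auto
  then have "y i = x (Suc (Suc i * (n - 1)))"
    unfolding y_def by (metis per)
  then show "P (y i) (y (Suc i))"
    using rel unfolding y_def by simp
  show "y (i + n) = y i"
    unfolding y_def using periodic_add_mult [of x n "i * (n - 1)" "n - 1", OF per]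
    by (simp only: add_mult_distrib mult.commute [of n])
  show "y 0 = x 0"
    by (simp add: y_def)
  show "y j = x (n - j)" if "j \<le> n"
  proof -
    have "j * (n - 1) + n = (n - j) + j * n"
      using that n by (cases n) (auto simp: algebra_simps)
    then show ?thesis
      unfolding y_def using per [of "j * (n - 1)"] periodic_add_mult [of x n "n - j" j, OF per] by simp
  qed
qed

lemma bounded_orbits_subsequence:
  fixes f :: "nat \<Rightarrow> nat \<Rightarrow> complex"
  assumes "\<And>k i. norm (f k i) \<le> B"
  obtains t x where "strict_mono (t :: nat \<Rightarrow> nat)" "\<And>i. (\<lambda>k. f (t k) i) \<longlonglongrightarrow> x i"
proof (rule function_convergent_subsequence [of UNIV f B])
  fix t :: "nat \<Rightarrow> nat"
  assume t: "strict_mono t" and "\<And>i. i \<in> UNIV \<Longrightarrow> \<exists>l. (\<lambda>k. f (t k) i) \<longlonglongrightarrow> l"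
  then have "\<forall>i. \<exists>l. (\<lambda>k. f (t k) i) \<longlonglongrightarrow> l"
    by simp
  then obtain x where "\<forall>i. (\<lambda>k. f (t k) i) \<longlonglongrightarrow> x i"
    by metis
  then show thesis
    using that t by blast
qed (use assms in auto)

text \<open>
  For two pairs of points related by the correspondence, \<open>A ^ p - B ^ p = (a - c) ^ q - (b - c) ^ q\<close>.
  Factoring out \<open>A - B\<close> and \<open>a - b\<close> leaves cofactors that are continuous in all points and in
  the parameter and whose quotient, when the pairs coincide, is the derivative. So a step of the inverse correspondence
  contracts nearly like the inverse of the derivative, up to a factor \<open>\<theta>\<close> as close to
  \<open>1\<close> as desired, and without any choice of branches.
\<close>

lemma root_step_lipschitz:
  assumes p: "1 \<le> p" and q: "1 \<le> q" and rel: "(w - c1) ^ q = y ^ p" and y: "y \<noteq> 0"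
    and \<theta>: "1 < \<theta>"
  obtains s where "0 < s"
    "\<And>c a b A B. \<lbrakk>dist c c1 < s; dist a w < s; dist b w < s; dist A y < s; dist B y < s;
       (a - c) ^ q = A ^ p; (b - c) ^ q = B ^ p\<rbrakk> \<Longrightarrow>
       dist A B * norm (step_factor p q c1 y w) \<le> \<theta> * dist a b"
proof -
  define S where "S m u v = (\<Sum>i<m. v ^ (m - Suc i) * u ^ i)" for m and u v :: complex
  have S: "u ^ m - v ^ m = (u - v) * S m u v" for m u v
    by (simp add: S_def power_diff_sumr2)
  have S_diag: "S m u u = of_nat m * u ^ (m - 1)" for m u
    by (simp add: S_def flip: power_add)
  have w: "w - c1 \<noteq> 0"
    using rel y q by (metis power_not_zero power_0_left not_one_le_zero)
  define F0 where "F0 = norm (of_nat q * (w - c1) ^ (q - 1))"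
  define G0 where "G0 = norm (of_nat p * y ^ (p - 1))"
  have pos: "0 < F0" "0 < G0"
    using w y p q by (auto simp: F0_def G0_def)
  \<comment> \<open>\<open>\<Phi>\<close> is continuous and positive where the pairs coincide; positivity is the estimate for the cofactors.\<close>
  define \<Phi> where "\<Phi> = (\<lambda>(c, a, b, A, B). \<theta> * F0 * norm (S p A B) - norm (S q (a - c) (b - c)) * G0)"
  have "isCont \<Phi> x" for x
    unfolding \<Phi>_def case_prod_beta S_def by (intro continuous_intros)
  then have "(\<Phi> \<longlongrightarrow> \<Phi> (c1, w, w, y, y)) (nhds (c1, w, w, y, y))"
    using continuous_at tendsto_at_iff_tendsto_nhds by blast
  moreover have "0 < \<Phi> (c1, w, w, y, y)"
    using pos \<theta> by (simp add: \<Phi>_def S_diag F0_def [symmetric, simplified] G0_def [symmetric, simplified])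
  ultimately have "\<forall>\<^sub>F x in nhds (c1, w, w, y, y). 0 < \<Phi> x"
    by (rule order_tendstoD(1))
  then obtain d where d: "0 < d" "\<And>x. dist x (c1, w, w, y, y) < d \<Longrightarrow> 0 < \<Phi> x"
    unfolding eventually_nhds_metric by blast
  have "dist A B * norm (step_factor p q c1 y w) \<le> \<theta> * dist a b"
    if close: "dist c c1 < d/5" "dist a w < d/5" "dist b w < d/5" "dist A y < d/5" "dist B y < d/5"
      and r: "(a - c) ^ q = A ^ p" "(b - c) ^ q = B ^ p" for c a b A B
  proof -
    define f where "f = norm (S q (a - c) (b - c))"
    define g where "g = norm (S p A B)"
    have tri: "dist (x, v) (x', v') \<le> dist x x' + dist v v'" for x x' :: "'s::metric_space" and v v' :: "'t::metric_space"
      by (simp add: dist_Pair_Pair sqrt_sum_squares_le_sum)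
    have "dist (c, a, b, A, B) (c1, w, w, y, y) \<le>
        dist c c1 + (dist a w + (dist b w + (dist A y + dist B y)))"
      by (meson tri order_trans add_left_mono)
    then have "0 < \<Phi> (c, a, b, A, B)"
      using close by (intro d) linarith
    then have fg: "f * G0 < \<theta> * F0 * g"
      by (simp add: \<Phi>_def f_def g_def)
    then have g: "0 < g"
      using pos \<theta> unfolding f_def g_def
      by (metis mult.right_neutral mult_nonneg_nonneg mult_zero_right norm_ge_zero not_less zero_less_norm_iff norm_zero less_eq_real_def)
    have "(A - B) * S p A B = (a - b) * S q (a - c) (b - c)"
      using S [of A p B] S [of "a - c" q "b - c"] r by simp
    then have "dist A B * g = dist a b * f"
      unfolding dist_norm f_def g_def by (metis norm_mult)
    then have "dist A B * G0 * g = dist a b * (f * G0)"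
      by (metis mult.assoc mult.commute)
    also have "\<dots> \<le> dist a b * (\<theta> * F0 * g)"
      using fg by (intro mult_left_mono) auto
    finally have "dist A B * G0 \<le> \<theta> * dist a b * F0"
      using g by (simp add: mult.assoc) (metis mult.assoc mult.commute mult_le_cancel_right_pos)
    moreover have "norm (step_factor p q c1 y w) = G0 / F0"
      by (simp add: step_factor_def norm_divide F0_def G0_def)
    moreover have "dist A B * (G0 / F0) \<le> \<theta> * dist a b"
      using calculation(1) pos by (simp add: field_simps)
    ultimately show ?thesis
      by simp
  qed
  then show ?thesis
    using that [of "d/5"] d(1) by auto
qed

text \<open>
  The Schwarz lemma on a ball: a uniformly bounded family is equicontinuous at the centre, with
  explicit constants.
\<close>

lemma holomorphic_bounded_dist_centre:
  assumes f: "f holomorphic_on ball a r" and B: "\<And>t. t \<in> ball a r \<Longrightarrow> norm (f t) < B"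
    and t: "t \<in> ball a r"
  shows "dist (f t) (f a) \<le> 2 * B * dist t a / r"
proof -
  have r: "0 < r"
    using t by (metis ball_empty empty_iff not_le)
  then have B0: "0 < B"
    using B [of a] by (simp add: norm_ge_zero le_less_trans) (meson le_less_trans norm_ge_zero)
  define g where "g s = (f (a + of_real r * s) - f a) / of_real (2 * B)" for s
  have in_ball: "a + of_real r * s \<in> ball a r" if "norm s < 1" for s
    using that r by (simp add: dist_norm norm_mult)
  have less_one: "norm (g s) < 1" if "norm s < 1" for s
  proof -
    have "norm (f (a + of_real r * s) - f a) < 2 * B"
      using B [OF in_ball [OF that]] B [of a] r norm_triangle_ineq4 [of "f (a + of_real r * s)" "f a"] by simp
    then show ?thesis
      using B0 by (simp add: g_def norm_divide norm_mult)
  qed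
  have "(f \<circ> (\<lambda>s. a + of_real r * s)) holomorphic_on ball 0 1"
    using in_ball by (intro holomorphic_on_compose_gen [OF _ f] holomorphic_intros) auto
  then have hol: "g holomorphic_on ball 0 1"
    unfolding g_def using B0 by (intro holomorphic_intros) (auto simp: o_def)
  have "g 0 = 0"
    by (simp add: g_def)
  moreover have "norm ((t - a) / of_real r) < 1"
    using t r by (simp add: dist_norm norm_divide norm_minus_commute)
  ultimately have "norm (g ((t - a) / of_real r)) \<le> norm ((t - a) / of_real r)"
    using Schwarz_Lemma(1) [OF hol _ less_one] by blast
  then show ?thesis
    using r B0 by (simp add: g_def dist_norm norm_divide norm_mult field_simps)
qed

text \<open>
  Otherwise Montel's theorem would give a limit that vanishes on the open set \<open>V\<close> but not on
  \<open>U\<close>.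
\<close>

lemma Vitali_convergence_zero:
  assumes U: "open U" "connected U" and V: "open V" "V \<noteq> {}" "V \<subseteq> U"
    and hol: "\<And>m::nat. g m holomorphic_on U" and B: "\<And>m t. t \<in> U \<Longrightarrow> norm (g m t) \<le> B"
    and lim: "\<And>t. t \<in> V \<Longrightarrow> (\<lambda>m. g m t) \<longlonglongrightarrow> 0" and t: "t \<in> U"
  shows "(\<lambda>m. g m t) \<longlonglongrightarrow> 0"
proof (rule ccontr)
  assume "\<not> ?thesis"
  then obtain e where e: "0 < e" "\<And>N. \<exists>m\<ge>N. e \<le> norm (g m t)"
    unfolding LIMSEQ_iff by (auto simp: not_less)
  then obtain s where s: "\<And>m. m \<le> s m \<and> e \<le> norm (g (s m) t)"
    by metis
  have s_lim: "filterlim s at_top sequentially"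
    using s by (auto intro!: filterlim_at_top_mono [OF filterlim_ident])
  obtain h r where h: "h holomorphic_on U" "strict_mono (r::nat \<Rightarrow> nat)"
      "\<And>x. x \<in> U \<Longrightarrow> (\<lambda>n. g (s (r n)) x) \<longlonglongrightarrow> h x"
    by (rule Montel [of U "range g" "\<lambda>n. g (s n)"]) (use U hol B in \<open>auto intro!: exI [of _ B]\<close>)
  have "h x = 0" if "x \<in> V" for x
  proof -
    have "(\<lambda>n. g (s (r n)) x) \<longlonglongrightarrow> 0"
      using filterlim_compose [OF lim [OF that] filterlim_compose [OF s_lim filterlim_subseq [OF h(2)]]] .
    then show ?thesis
      using h(3) LIMSEQ_unique that V(3) by blast
  qed
  then have "h t = 0"
    using analytic_continuation_open [OF V(1) U(1) V(2) U(2) V(3) h(1), of "\<lambda>_. 0"] t by auto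
  then have "(\<lambda>n. norm (g (s (r n)) t)) \<longlonglongrightarrow> 0"
    using h(3) [OF t] tendsto_norm_zero by auto
  then have "e \<le> 0"
    using s by (intro LIMSEQ_le_const) auto
  then show False
    using e by simp
qed


context backward_trap
begin

text \<open>
  Let \<open>y\<close> be the cycle run backwards. Starting with the constant \<open>\<zeta>\<^sub>0 = y\<^sub>0\<close>, lifting with the
  parameter as variable gives holomorphic \<open>\<zeta>\<^sub>k\<close> from \<open>U\<close> to \<open>\<Omega>\<close> with \<open>(\<zeta>\<^sub>k(c) - c)\<^sup>q = \<zeta>\<^sub>k\<^sub>+\<^sub>1(c)\<^sup>p\<close> and
  \<open>\<zeta>\<^sub>k(c1) = y\<^sub>k\<close>. Near \<open>c1\<close> these functions stay close to the cycle, which is repelling, so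
  \<open>n\<close> successive lifts contract distances and \<open>\<zeta>\<^sub>k\<^sub>+\<^sub>n - \<zeta>\<^sub>k\<close> tends to \<open>0\<close>. By Vitali's argument it
  tends to \<open>0\<close> on all of \<open>U\<close>. Hence for any limit \<open>\<xi>\<close> of a subsequence of \<open>\<zeta>\<^sub>k\<^sub>n\<close> the value
  \<open>\<xi>(c)\<close> is periodic of period \<open>n\<close> for every \<open>c \<in> U\<close>.
\<close>

lemma cycle_continuation:
  assumes c1: "c1 \<in> U" and cyc: "cycle_of_period p q c1 n z" and z\<Omega>: "range z \<subseteq> \<Omega>"
  obtains \<zeta> where "\<zeta> holomorphic_on U" "\<zeta> c1 = z 0"
    "\<And>c. c \<in> U \<Longrightarrow> \<exists>x. cycle_of_period p q c n x \<and> range x \<subseteq> \<Omega> \<and> x 0 = \<zeta> c"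
proof -
  have n: "1 \<le> n" and z_per: "\<And>i. z (i + n) = z i" and z_rel: "\<And>i. (z (Suc i) - c1) ^ q = z i ^ p"
    using cyc by (auto simp: cycle_of_period_def forward_orbit_def corr_def)
  define y where "y k = z (k * (n - 1))" for k
  have y_rel: "(y k - c1) ^ q = y (Suc k) ^ p" and y_per: "y (k + n) = y k"
    and y0: "y 0 = z 0" and y_rev: "j \<le> n \<Longrightarrow> y j = z (n - j)" for k j
    using reverse_periodic_relation [of z n "\<lambda>u v. (u - c1) ^ q = v ^ p", OF z_per n z_rel]
    by (simp_all add: y_def)
  have y\<Omega>: "y k \<in> \<Omega>" for k
    using z\<Omega> by (auto simp: y_def)
  then have y_nz: "y k \<noteq> 0" for k
    using zero_notin by metis
  obtain B where B: "\<And>w. w \<in> \<Omega> \<Longrightarrow> norm w < B"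
    using bounded_\<Omega> by (metis bounded_pos_less)
  define \<nu> where "\<nu> k = norm (step_factor p q c1 (y (Suc k)) (y k))" for k
  have \<nu>_per: "\<nu> (k + n) = \<nu> k" for k
    using y_per [of k] y_per [of "Suc k"] by (simp add: \<nu>_def)
  define \<Lambda> where "\<Lambda> = (\<Prod>j<n. \<nu> j)"
  have "1 < (\<Prod>i<n. norm (step_factor p q c1 (z i) (z (Suc i))))"
    using cycle_multiplier_gt_one [OF c1 _ n _ z\<Omega>] cyc z_per [of 0]
    by (simp add: cycle_of_period_def prod_norm)
  also have "\<dots> = \<Lambda>"
    unfolding \<Lambda>_def by (subst prod.nat_diff_reindex [symmetric]) (auto simp: \<nu>_def y_rev Suc_diff_Suc intro!: prod.cong)
  finally have \<nu>_prod: "1 < \<Lambda>" .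
  \<comment> \<open>Any \<open>\<theta> > 1\<close> with \<open>\<theta>\<^sup>n < \<Lambda>\<close> would do: the loss \<open>\<theta>\<close> of each step must not destroy the contraction of a period.\<close>
  define \<theta> where "\<theta> = \<Lambda> powr (1 / (2 * real n))"
  have \<theta>: "1 < \<theta>"
    using \<nu>_prod n by (simp add: \<theta>_def)
  have \<theta>_pow: "\<theta> ^ n < \<Lambda>"
  proof -
    have "\<theta> ^ n = \<Lambda> powr (1/2)"
      using \<nu>_prod n \<theta> unfolding \<theta>_def by (subst powr_realpow [symmetric]) (auto simp: powr_powr)
    also have "\<dots> < \<Lambda> powr 1"
      using \<nu>_prod by (intro powr_less_mono) auto
    finally show ?thesis
      using \<nu>_prod by simp
  qed

  have "\<exists>\<zeta>. \<forall>k. (\<zeta> k holomorphic_on U \<and> \<zeta> k c1 = y k \<and> \<zeta> k ` U \<subseteq> \<Omega>) \<and>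
      (\<forall>c\<in>U. (\<zeta> k c - c) ^ q = \<zeta> (Suc k) c ^ p \<and> ball (\<zeta> (Suc k) c) \<epsilon> \<subseteq> \<Omega>)"
  proof (rule dependent_nat_choice)
    show "\<exists>f. f holomorphic_on U \<and> f c1 = y 0 \<and> f ` U \<subseteq> \<Omega>"
      using y\<Omega> by (intro exI [of _ "\<lambda>_. y 0"]) auto
  next
    fix f k assume f: "f holomorphic_on U \<and> f c1 = y k \<and> f ` U \<subseteq> \<Omega>"
    obtain h where "h holomorphic_on U" "h c1 = y (Suc k)"
        "\<And>t. t \<in> U \<Longrightarrow> (f t - t) ^ q = h t ^ p" "\<And>t. t \<in> U \<Longrightarrow> ball (h t) \<epsilon> \<subseteq> \<Omega>"
      using lift_exists [OF open_U convex_U c1, of f "\<lambda>t. t" "y (Suc k)"] f y_rel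
      by (auto simp: holomorphic_on_ident)
    then show "\<exists>h. (h holomorphic_on U \<and> h c1 = y (Suc k) \<and> h ` U \<subseteq> \<Omega>) \<and>
        (\<forall>c\<in>U. (f c - c) ^ q = h c ^ p \<and> ball (h c) \<epsilon> \<subseteq> \<Omega>)"
      using \<epsilon>_pos by (intro exI [of _ h]) (force simp: subset_iff)
  qed
  then obtain \<zeta> where \<zeta>: "\<forall>k. (\<zeta> k holomorphic_on U \<and> \<zeta> k c1 = y k \<and> \<zeta> k ` U \<subseteq> \<Omega>) \<and>
      (\<forall>c\<in>U. (\<zeta> k c - c) ^ q = \<zeta> (Suc k) c ^ p \<and> ball (\<zeta> (Suc k) c) \<epsilon> \<subseteq> \<Omega>)"
    by blast
  then have hol: "\<zeta> k holomorphic_on U" and \<zeta>_c1: "\<zeta> k c1 = y k" for k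
    by auto
  have \<zeta>\<Omega>: "\<zeta> k c \<in> \<Omega>" and \<zeta>_rel: "(\<zeta> k c - c) ^ q = \<zeta> (Suc k) c ^ p"
    and \<zeta>_ball: "ball (\<zeta> (Suc k) c) \<epsilon> \<subseteq> \<Omega>" if "c \<in> U" for k c
    using \<zeta> that by (auto simp: image_subset_iff)

  have "\<exists>s>0. \<forall>c a b A B. dist c c1 < s \<longrightarrow> dist a (y k) < s \<longrightarrow> dist b (y k) < s \<longrightarrow>
      dist A (y (Suc k)) < s \<longrightarrow> dist B (y (Suc k)) < s \<longrightarrow>
      (a - c) ^ q = A ^ p \<longrightarrow> (b - c) ^ q = B ^ p \<longrightarrow> dist A B * \<nu> k \<le> \<theta> * dist a b" for k
    using root_step_lipschitz [OF _ q_pos y_rel y_nz \<theta>, of k] q_less_p unfolding \<nu>_def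
    by (metis One_nat_def Suc_leI less_imp_Suc_add zero_less_Suc)
  then obtain s where s: "\<And>k. 0 < s k" "\<And>k c a b A B. \<lbrakk>dist c c1 < s k; dist a (y k) < s k; dist b (y k) < s k;
      dist A (y (Suc k)) < s k; dist B (y (Suc k)) < s k;
      (a - c) ^ q = A ^ p; (b - c) ^ q = B ^ p\<rbrakk> \<Longrightarrow> dist A B * \<nu> k \<le> \<theta> * dist a b"
    by metis
  \<comment> \<open>By periodicity finitely many radii \<open>s k\<close> suffice, so a common one exists.\<close>
  define \<sigma> where "\<sigma> = Min (s ` {..<n})"
  have \<sigma>: "0 < \<sigma>" "\<And>k. k < n \<Longrightarrow> \<sigma> \<le> s k"
    using n s(1) by (auto simp: \<sigma>_def Min_gr_iff lessThan_empty_iff)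
  have step: "dist A B * \<nu> k \<le> \<theta> * dist a b"
    if "dist c c1 < \<sigma>" "dist a (y k) < \<sigma>" "dist b (y k) < \<sigma>" "dist A (y (Suc k)) < \<sigma>" "dist B (y (Suc k)) < \<sigma>"
      "(a - c) ^ q = A ^ p" "(b - c) ^ q = B ^ p" for k c a b A B
  proof -
    have k: "y (k mod n) = y k" "y (Suc (k mod n)) = y (Suc k)" "\<nu> (k mod n) = \<nu> k"
      using periodic_add_mult [of y n "k mod n" "k div n", OF y_per]
        periodic_add_mult [of y n "Suc (k mod n)" "k div n", OF y_per]
        periodic_add_mult [of \<nu> n "k mod n" "k div n", OF \<nu>_per] by auto
    have "\<sigma> \<le> s (k mod n)"
      using n by (intro \<sigma>(2)) auto
    then show ?thesis
      using s(2) [of c "k mod n" a b A B] that unfolding k by linarith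
  qed

  obtain \<rho>0 where \<rho>0: "0 < \<rho>0" "ball c1 \<rho>0 \<subseteq> U"
    using open_U c1 by (meson open_contains_ball)
  have B0: "0 < B"
    using B [OF y\<Omega> [of 0]] by (meson le_less_trans norm_ge_zero)
  \<comment> \<open>On this ball the Schwarz lemma keeps all \<open>\<zeta> k\<close> within \<open>\<sigma>\<close> of the cycle.\<close>
  define \<rho> where "\<rho> = min (min \<rho>0 \<sigma>) (\<sigma> * \<rho>0 / (2 * B))"
  have \<rho>: "0 < \<rho>" "\<rho> \<le> \<rho>0" "\<rho> \<le> \<sigma>" "\<rho> \<le> \<sigma> * \<rho>0 / (2 * B)"
    using \<rho>0 \<sigma> B0 by (auto simp: \<rho>_def)
  have ball_sub: "ball c1 \<rho> \<subseteq> U"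
    using \<rho>0 \<rho> by (meson order_trans subset_ball)
  have near: "dist (\<zeta> k c) (y k) < \<sigma>" if c: "c \<in> ball c1 \<rho>" for k c
  proof -
    have "dist (\<zeta> k c) (\<zeta> k c1) \<le> 2 * B * dist c c1 / \<rho>0"
      using \<rho>0 \<rho> c \<zeta>\<Omega> B by (intro holomorphic_bounded_dist_centre holomorphic_on_subset [OF hol]) auto
    also have "\<dots> < \<sigma>"
    proof -
      have "dist c c1 < \<sigma> * \<rho>0 / (2 * B)"
        using c \<rho>(4) by (simp add: dist_commute)
      then show ?thesis
        using B0 \<rho>0(1) by (simp add: field_simps)
    qed
    finally show ?thesis
      by (simp add: \<zeta>_c1)
  qed
  define g where "g m c = \<zeta> (m + n) c - \<zeta> m c" for m c
  have g_bound: "norm (g m c) \<le> 2 * B" if "c \<in> U" for m c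
    using B [OF \<zeta>\<Omega> [OF that, of m]] B [OF \<zeta>\<Omega> [OF that, of "m + n"]]
      norm_triangle_ineq4 [of "\<zeta> (m + n) c" "\<zeta> m c"] by (simp add: g_def)
  define \<kappa> where "\<kappa> = \<theta> ^ n / \<Lambda>"
  have \<kappa>: "0 \<le> \<kappa>" "\<kappa> < 1"
    using \<theta>_pow \<nu>_prod \<theta> by (auto simp: \<kappa>_def)
  have g_local: "(\<lambda>m. g m c) \<longlonglongrightarrow> 0" if c: "c \<in> ball c1 \<rho>" for c
  proof -
    have cU: "c \<in> U"
      using c ball_sub by auto
    have one: "norm (g (Suc m) c) * \<nu> m \<le> \<theta> * norm (g m c)" for m
    proof -
      have "dist (\<zeta> (m + n) c) (y m) < \<sigma>" "dist (\<zeta> (Suc (m + n)) c) (y (Suc m)) < \<sigma>"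
        using near [OF c, of "m + n"] near [OF c, of "Suc m + n"] y_per [of m] y_per [of "Suc m"] by simp_all
      then show ?thesis
        using step [of c "\<zeta> (m + n) c" m "\<zeta> m c" "\<zeta> (Suc (m + n)) c" "\<zeta> (Suc m) c"]
          near [OF c] \<zeta>_rel [OF cU] c \<rho>(3) by (simp add: g_def dist_norm norm_minus_commute)
    qed
    have "norm (g (m + j) c) * (\<Prod>i<j. \<nu> (m + i)) \<le> \<theta> ^ j * norm (g m c)" for m j
    proof (induction j)
      case (Suc j)
      have "norm (g (m + Suc j) c) * (\<Prod>i<Suc j. \<nu> (m + i)) =
          norm (g (Suc (m + j)) c) * \<nu> (m + j) * (\<Prod>i<j. \<nu> (m + i))"
        by simp
      also have "\<dots> \<le> \<theta> * norm (g (m + j) c) * (\<Prod>i<j. \<nu> (m + i))"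
        using one by (intro mult_right_mono prod_nonneg) (auto simp: \<nu>_def)
      also have "\<dots> \<le> \<theta> * (\<theta> ^ j * norm (g m c))"
        using Suc \<theta> by (simp add: mult.assoc)
      finally show ?case
        by (simp add: mult.assoc)
    qed simp
    from this [of _ n] have block: "norm (g (m + n) c) \<le> \<kappa> * norm (g m c)" for m
      using \<nu>_prod prod_periodic_shift [of \<nu> n, OF \<nu>_per] by (simp add: \<kappa>_def field_simps flip: \<Lambda>_def)
    have geom: "norm (g (m + k * n) c) \<le> \<kappa> ^ k * (2 * B)" for m k
    proof (induction k)
      case 0
      show ?case using g_bound [OF cU] by simp
    next
      case (Suc k)
      have "norm (g (m + Suc k * n) c) \<le> \<kappa> * norm (g (m + k * n) c)"
        using block [of "m + k * n"] by (simp add: algebra_simps)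
      also have "\<dots> \<le> \<kappa> * (\<kappa> ^ k * (2 * B))"
        using Suc \<kappa> by (intro mult_left_mono)
      finally show ?case by simp
    qed
    have "(\<lambda>m. \<kappa> ^ (m div n)) \<longlonglongrightarrow> 0"
      using n \<kappa> by (intro filterlim_compose [OF LIMSEQ_power_zero filterlim_at_top_div_const_nat]) auto
    then have "(\<lambda>m. \<kappa> ^ (m div n) * (2 * B)) \<longlonglongrightarrow> 0"
      by (rule tendsto_mult_left_zero)
    moreover have "norm (g m c) \<le> \<kappa> ^ (m div n) * (2 * B)" for m
      using geom [of "m mod n" "m div n"] by simp
    ultimately show ?thesis
      by (intro Lim_null_comparison [of "\<lambda>m. g m c"]) auto
  qed
  have g_lim: "(\<lambda>m. g m c) \<longlonglongrightarrow> 0" if "c \<in> U" for c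
  proof (rule Vitali_convergence_zero [of U "ball c1 \<rho>" g])
    show "g m holomorphic_on U" for m
      unfolding g_def by (intro holomorphic_intros hol)
  qed (use open_U convex_U convex_connected \<rho> ball_sub g_bound g_local that in auto)

  obtain \<xi> r where \<xi>: "\<xi> holomorphic_on U" and r: "strict_mono (r :: nat \<Rightarrow> nat)"
      and lim: "\<And>c. c \<in> U \<Longrightarrow> (\<lambda>k. \<zeta> (r k * n) c) \<longlonglongrightarrow> \<xi> c"
    by (rule Montel [of U "range \<zeta>" "\<lambda>k. \<zeta> (k * n)"])
      (use open_U hol \<zeta>\<Omega> B in \<open>auto simp: image_subset_iff intro!: exI [of _ B] less_imp_le\<close>)
  show ?thesis
  proof
    show "\<xi> holomorphic_on U" by fact
    have "\<zeta> (r k * n) c1 = z 0" for k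
      using periodic_add_mult [of y n 0 "r k", OF y_per] by (simp add: \<zeta>_c1 y0)
    then show "\<xi> c1 = z 0"
      using lim [OF c1] by (simp add: LIMSEQ_const_iff)
    fix c assume c: "c \<in> U"
    have "norm (\<zeta> (r k * n + i) c) \<le> B" for k i
      using B \<zeta>\<Omega> c by (intro less_imp_le) auto
    \<comment> \<open>For this one \<open>c\<close>, a further subsequence makes the whole backward orbits of the lifts converge.\<close>
    then obtain t x where t: "strict_mono (t :: nat \<Rightarrow> nat)"
        and x: "\<And>i. (\<lambda>k. \<zeta> (r (t k) * n + i) c) \<longlonglongrightarrow> x i"
      using bounded_orbits_subsequence [of "\<lambda>k i. \<zeta> (r k * n + i) c" B] by metis
    have rt: "filterlim (\<lambda>k. r (t k) * n + i) at_top sequentially" for i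
    proof -
      have "strict_mono (\<lambda>k. r (t k) * n + i)"
        using r t n by (auto simp: strict_mono_def)
      then show ?thesis
        by (rule filterlim_subseq)
    qed
    have x0: "x 0 = \<xi> c"
      using LIMSEQ_unique [OF x [of 0]] LIMSEQ_subseq_LIMSEQ [OF lim [OF c] t] by (simp add: o_def)
    have x_per: "x (i + n) = x i" for i
    proof -
      have "(\<lambda>k. g (r (t k) * n + i) c) \<longlonglongrightarrow> x (i + n) - x i"
        unfolding g_def using tendsto_diff [OF x [of "i + n"] x [of i]] by (simp add: add.assoc)
      moreover have "(\<lambda>k. g (r (t k) * n + i) c) \<longlonglongrightarrow> 0"
        by (rule filterlim_compose [OF g_lim [OF c] rt])
      ultimately show ?thesis
        using LIMSEQ_unique by fastforce
    qed
    have x_rel: "(x i - c) ^ q = x (Suc i) ^ p" for i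
    proof -
      have "(\<lambda>k. (\<zeta> (r (t k) * n + i) c - c) ^ q) \<longlonglongrightarrow> (x i - c) ^ q"
        by (intro tendsto_intros x)
      moreover have "(\<lambda>k. \<zeta> (r (t k) * n + Suc i) c ^ p) \<longlonglongrightarrow> x (Suc i) ^ p"
        by (intro tendsto_intros x)
      ultimately show ?thesis
        using \<zeta>_rel [OF c] LIMSEQ_unique by fastforce
    qed
    have "x (Suc i) \<in> \<Omega>" for i
    proof -
      have "\<forall>\<^sub>F k in sequentially. dist (\<zeta> (r (t k) * n + Suc i) c) (x (Suc i)) < \<epsilon>"
        using x \<epsilon>_pos by (rule tendstoD)
      then obtain k where "dist (\<zeta> (r (t k) * n + Suc i) c) (x (Suc i)) < \<epsilon>"
        using eventually_happens trivial_limit_sequentially by blast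
      then show ?thesis
        using \<zeta>_ball [OF c, of "r (t k) * n + i"] by auto
    qed
    then have x\<Omega>: "x i \<in> \<Omega>" for i
      using x_per [of i] n by (metis One_nat_def Suc_le_D add_Suc_right)
    have "cycle_of_period p q c n (\<lambda>i. x (i * (n - 1)))"
      using reverse_periodic_relation [of x n "\<lambda>v u. (u - c) ^ q = v ^ p", OF x_per n] x_rel n
      by (auto simp: cycle_of_period_def forward_orbit_def corr_def)
    then show "\<exists>x. cycle_of_period p q c n x \<and> range x \<subseteq> \<Omega> \<and> x 0 = \<xi> c"
      using x\<Omega> x0 by (intro exI [of _ "\<lambda>i. x (i * (n - 1))"]) auto
  qed
qed

end

section \<open>Escape and pseudo-orbits\<close>

text \<open>
  The value \<open>\<alpha> ^ q - u'\<close> of the polynomial \<open>X\<^sup>q - u'\<close> at \<open>\<alpha>\<close> is the product of the differences between \<open>\<alpha>\<close>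
  and the roots of the polynomial, so these differences cannot all be large. Unlike an argument
  with branches of the root, the estimate is uniform near \<open>u' = 0\<close>.
\<close>

lemma exists_near_root:
  fixes \<alpha> u' :: complex
  assumes q: "1 \<le> q" and \<rho>: "0 < \<rho>" and near: "norm (\<alpha> ^ q - u') < \<rho> ^ q"
  obtains \<alpha>' where "\<alpha>' ^ q = u'" "dist \<alpha> \<alpha>' < \<rho>"
proof (rule ccontr)
  assume "\<not> thesis"
  then have far: "\<rho> \<le> norm (\<alpha> - x)" if "x ^ q = u'" for x
    using that \<open>\<And>\<alpha>'. \<lbrakk>\<alpha>' ^ q = u'; dist \<alpha> \<alpha>' < \<rho>\<rbrakk> \<Longrightarrow> thesis\<close> by (force simp: dist_norm not_less)
  define P where "P = monom 1 q - [:u':]"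
  have deg: "degree P = q" "lead_coeff P = 1"
  proof -
    have "degree P = degree (monom (1::complex) q)"
      using q unfolding P_def diff_conv_add_uminus by (intro degree_add_eq_left) (auto simp: degree_monom_eq)
    then show "degree P = q"
      by (simp add: degree_monom_eq)
    then show "lead_coeff P = 1"
      using q by (cases q) (auto simp: P_def coeff_pCons)
  qed
  have P_poly: "poly P x = x ^ q - u'" for x
    by (simp add: P_def poly_monom)
  obtain A where A: "size A = q" "P = (\<Prod>x\<in>#A. [:-x, 1:])"
    using alg_closed_imp_factorization [of P] deg q by fastforce
  have P_prod: "poly P y = (\<Prod>x\<in>#A. y - x)" for y
    by (simp add: A(2) poly_prod_mset image_mset.compositionality o_def)
  have "x ^ q = u'" if "x \<in># A" for x
  proof -
    have "poly P x = 0"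
      using that unfolding P_prod by (force simp: prod_mset_zero_iff)
    then show ?thesis
      by (simp add: P_poly)
  qed
  then have "\<rho> ^ size B \<le> norm (\<Prod>x\<in>#B. \<alpha> - x)" if "B \<subseteq># A" for B
    using that
  proof (induction B)
    case (add x B)
    then have "\<rho> \<le> norm (\<alpha> - x)" "\<rho> ^ size B \<le> norm (\<Prod>x\<in>#B. \<alpha> - x)"
      using far by (auto dest: mset_subset_eq_insertD subset_mset.less_imp_le)
    then show ?case
      using \<rho> by (simp add: norm_mult mult_mono)
  qed simp
  from this [of A] show False
    using near A(1) P_prod P_poly by simp
qed

lemma exists_near_root_uniform:
  assumes q: "1 \<le> q" and \<rho>: "0 < \<rho>"
  obtains \<epsilon> where "0 < \<epsilon>" "\<epsilon> \<le> 1"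
    "\<And>\<alpha> z z' :: complex. \<lbrakk>norm z \<le> B; dist z z' < \<epsilon>; \<alpha> ^ q = z ^ p\<rbrakk> \<Longrightarrow> \<exists>\<alpha>'. \<alpha>' ^ q = z' ^ p \<and> dist \<alpha> \<alpha>' < \<rho>"
proof -
  have "uniformly_continuous_on (cball 0 (B + 1)) (\<lambda>z::complex. z ^ p)"
    by (intro compact_uniformly_continuous continuous_intros) auto
  moreover have "0 < \<rho> ^ q"
    using \<rho> by simp
  ultimately obtain d where d: "0 < d" "\<And>z z' :: complex. \<lbrakk>z \<in> cball 0 (B + 1); z' \<in> cball 0 (B + 1); dist z' z < d\<rbrakk>
      \<Longrightarrow> dist (z' ^ p) (z ^ p) < \<rho> ^ q"
    unfolding uniformly_continuous_on_def by metis
  have "\<exists>\<alpha>'. \<alpha>' ^ q = z' ^ p \<and> dist \<alpha> \<alpha>' < \<rho>"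
    if z: "norm z \<le> B" "dist z z' < min d 1" "\<alpha> ^ q = z ^ p" for \<alpha> z z' :: complex
  proof -
    have "norm z' \<le> B + 1"
      using z norm_triangle_ineq2 [of z' z] by (simp add: dist_norm norm_minus_commute)
    then have "norm (\<alpha> ^ q - z' ^ p) < \<rho> ^ q"
      using d(2) [of z z'] z by (simp add: dist_norm norm_minus_commute)
    then show ?thesis
      using exists_near_root q \<rho> by metis
  qed
  then show ?thesis
    using that [of "min d 1"] d(1) by auto
qed

text \<open>
  The constant is chosen for all parameters at distance at most \<open>1\<close> from \<open>a\<close>: beyond it,
  \<open>|w - c| < 2|z|\<close> for every \<open>w\<close> with \<open>|w| < |z| + 1\<close>, and \<open>2\<^sup>q \<le> |z|\<close>.
\<close>

definition escape_radius :: "nat \<Rightarrow> complex \<Rightarrow> real" where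
  "escape_radius q a = 2 ^ q + norm a + 3"

text \<open>
  If \<open>|w| < |z| + 1\<close>, then \<open>|z|\<^sup>p = |w - c|\<^sup>q < (2|z|)\<^sup>q \<le> |z|\<^sup>q\<^sup>+\<^sup>1 \<le> |z|\<^sup>p\<close>.
\<close>

lemma escape_step:
  assumes q: "1 \<le> q" "q < p" and c: "c \<in> cball a 1"
    and rel: "(w - c) ^ q = z ^ p" and z: "escape_radius q a - 1 \<le> norm z"
  shows "norm z + 1 \<le> norm w"
proof (rule ccontr)
  assume "\<not> ?thesis"
  moreover have "norm c \<le> norm a + 1"
    using c norm_triangle_ineq2 [of c a] by (simp add: dist_norm norm_minus_commute)
  moreover have big: "2 ^ q + norm a + 2 \<le> norm z"
    using z by (simp add: escape_radius_def)
  moreover have "(0::real) < 2 ^ q"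
    by simp
  ultimately have "norm (w - c) < 2 * norm z"
    using norm_triangle_ineq4 [of w c] by linarith
  then have "norm (w - c) ^ q < (2 * norm z) ^ q"
    using q by (intro power_strict_mono) auto
  also have "\<dots> = 2 ^ q * norm z ^ q"
    by (simp add: power_mult_distrib)
  also have "\<dots> \<le> norm z * norm z ^ q"
    using big norm_ge_zero [of a]
    by (intro mult_right_mono zero_le_power norm_ge_zero) linarith
  also have "\<dots> = norm z ^ Suc q"
    by simp
  also have "\<dots> \<le> norm z ^ p"
  proof (rule power_increasing)
    have "(1::real) \<le> 2 ^ q" by simp
    then show "1 \<le> norm z"
      using big norm_ge_zero [of a] by linarith
  qed (use q in simp)
  finally show False
    using rel by (metis less_irrefl norm_power)
qed

lemma bounded_orbit_in_disc:
  assumes q: "1 \<le> q" "q < p" and c: "c \<in> cball a 1"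
    and orb: "forward_orbit p q c w" and bdd: "bounded (range w)"
  shows "norm (w i) < escape_radius q a - 1"
proof (rule ccontr)
  assume "\<not> ?thesis"
  then have big: "escape_radius q a - 1 \<le> norm (w i)"
    by simp
  have rel: "(w (Suc j) - c) ^ q = w j ^ p" for j
    using orb by (simp add: forward_orbit_def corr_def)
  have grow: "norm (w i) + real k \<le> norm (w (i + k))" for k
  proof (induction k)
    case (Suc k)
    then have "norm (w (i + k)) + 1 \<le> norm (w (Suc (i + k)))"
      using big by (intro escape_step [OF q c rel]) simp
    then show ?case
      using Suc by simp
  qed simp
  obtain B where B: "\<And>j. norm (w j) \<le> B"
    using bdd by (auto simp: bounded_iff)
  obtain k where "B < real k"
    using reals_Archimedean2 by blast
  then show False
    using grow [of k] B [of "i + k"] norm_ge_zero [of "w i"] by linarith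
qed

text \<open>
  The parameter may change from step to step. This absorbs both a perturbation of the parameter
  and a perturbation of the starting point, since the latter can be corrected in the first step.
  Only the terms up to index \<open>N\<close> matter.
\<close>

definition pseudo_orbit :: "nat \<Rightarrow> nat \<Rightarrow> complex \<Rightarrow> real \<Rightarrow> nat \<Rightarrow> (nat \<Rightarrow> complex) \<Rightarrow> bool" where
  "pseudo_orbit p q a r N w \<longleftrightarrow> (\<forall>i<N. \<exists>c\<in>cball a r. (w (Suc i) - c) ^ q = w i ^ p)"

lemma pseudo_orbit_mono:
  "\<lbrakk>pseudo_orbit p q a r N w; r \<le> r'; N' \<le> N\<rbrakk> \<Longrightarrow> pseudo_orbit p q a r' N' w"
  unfolding pseudo_orbit_def by (meson less_le_trans mem_cball order_trans)

lemma forward_orbit_imp_pseudo_orbit: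
  "\<lbrakk>forward_orbit p q c w; c \<in> cball a r\<rbrakk> \<Longrightarrow> pseudo_orbit p q a r N w"
  by (auto simp: forward_orbit_def corr_def pseudo_orbit_def)

lemma forward_orbit_shift: "forward_orbit p q c w \<Longrightarrow> forward_orbit p q c (\<lambda>j. w (i + j))"
  by (simp add: forward_orbit_def)

text \<open>
  Longer and longer bounded pseudo-orbits with smaller and smaller errors subconverge, term by
  term, to an infinite bounded orbit of the limiting parameter. This compactness statement takes the place of
  Koenig's lemma for the tree of orbits.
\<close>

lemma pseudo_orbits_limit:
  assumes orb: "\<And>k. pseudo_orbit p q a (1 / Suc k) k (\<omega> k)"
    and bdd: "\<And>k i. i \<le> k \<Longrightarrow> norm (\<omega> k i) \<le> R"
  obtains t x where "strict_mono (t :: nat \<Rightarrow> nat)" "\<And>i. (\<lambda>k. \<omega> (t k) i) \<longlonglongrightarrow> x i"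
    "forward_orbit p q a x" "\<And>i. norm (x i) \<le> R"
proof -
  have "0 \<le> R"
    using bdd [of 0 0] norm_ge_zero order_trans by blast
  then have "norm (if i \<le> k then \<omega> k i else 0) \<le> R" for k i
    using bdd by auto
  then obtain t x where t: "strict_mono (t :: nat \<Rightarrow> nat)"
      and x: "\<And>i. (\<lambda>k. if i \<le> t k then \<omega> (t k) i else 0) \<longlonglongrightarrow> x i"
    using bounded_orbits_subsequence [of "\<lambda>k i. if i \<le> k then \<omega> k i else 0" R] by metis
  have large: "\<forall>\<^sub>F k in sequentially. i \<le> t k" for i
    using filterlim_subseq [OF t] by (simp add: filterlim_at_top)
  have lim: "(\<lambda>k. \<omega> (t k) i) \<longlonglongrightarrow> x i" for i
    by (rule Lim_transform_eventually [OF x]) (use large [of i] in \<open>auto elim: eventually_mono\<close>)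
  have "norm (x i) \<le> R" for i
    by (rule Lim_norm_ubound [OF _ lim]) (use large [of i] bdd in \<open>auto elim: eventually_mono\<close>)
  moreover have "(x (Suc i) - a) ^ q = x i ^ p" for i
  proof -
    have "\<forall>k. \<exists>c. i < k \<longrightarrow> c \<in> cball a (1 / Suc k) \<and> (\<omega> k (Suc i) - c) ^ q = \<omega> k i ^ p"
      using orb unfolding pseudo_orbit_def by blast
    then obtain c where c: "\<And>k. i < k \<Longrightarrow> dist a (c k) \<le> 1 / Suc k \<and> (\<omega> k (Suc i) - c k) ^ q = \<omega> k i ^ p"
      by (metis mem_cball)
    have ev: "\<forall>\<^sub>F k in sequentially. i < t k"
      using large [of "Suc i"] by (simp add: Suc_le_eq)
    have "(\<lambda>k. 1 / real (Suc (t k))) \<longlonglongrightarrow> 0"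
      using LIMSEQ_subseq_LIMSEQ [OF lim_inverse_n' [THEN LIMSEQ_Suc] t] by (simp add: o_def)
    then have "(\<lambda>k. c (t k) - a) \<longlonglongrightarrow> 0"
      by (rule Lim_null_comparison [rotated])
        (use ev c in \<open>auto elim!: eventually_mono simp: dist_norm norm_minus_commute\<close>)
    then have "(\<lambda>k. c (t k)) \<longlonglongrightarrow> a"
      by (simp add: Lim_null [of _ a])
    then have l1: "(\<lambda>k. (\<omega> (t k) (Suc i) - c (t k)) ^ q) \<longlonglongrightarrow> (x (Suc i) - a) ^ q"
      by (intro tendsto_intros lim)
    have l2: "(\<lambda>k. \<omega> (t k) i ^ p) \<longlonglongrightarrow> x i ^ p"
      by (intro tendsto_intros lim)
    have "\<forall>\<^sub>F k in sequentially. (\<omega> (t k) (Suc i) - c (t k)) ^ q = \<omega> (t k) i ^ p"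
      using ev c by (auto elim: eventually_mono)
    from LIMSEQ_unique [OF Lim_transform_eventually [OF l1 this] l2] show ?thesis .
  qed
  ultimately show ?thesis
    using that [OF t lim] by (simp add: forward_orbit_def corr_def)
qed

text \<open>
  One index \<open>k\<close> controls the error, the length and the distance of the starting point from
  \<open>0\<close>, so that a statement about all sufficiently small errors and distances and all large
  lengths is one that holds eventually in \<open>k\<close>.
\<close>

definition near_orbit :: "nat \<Rightarrow> nat \<Rightarrow> complex \<Rightarrow> real \<Rightarrow> nat \<Rightarrow> (nat \<Rightarrow> complex) \<Rightarrow> bool" where
  "near_orbit p q a R k w \<longleftrightarrow> pseudo_orbit p q a (1 / Suc k) k w \<and> norm (w 0) \<le> 1 / Suc k \<and>
     (\<forall>i\<le>k. norm (w i) \<le> R)"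

lemma near_orbit_antimono:
  assumes "near_orbit p q a R k' w" "k \<le> k'"
  shows "near_orbit p q a R k w"
proof -
  have "1 / real (Suc k') \<le> 1 / real (Suc k)"
    using assms(2) by (simp add: frac_le)
  then show ?thesis
    using assms pseudo_orbit_mono unfolding near_orbit_def by (meson order_trans)
qed

lemma eventually_near_orbit_avoids:
  assumes C: "closed C"
    and no: "\<And>x. \<lbrakk>forward_orbit p q a x; x 0 = 0; \<And>i. norm (x i) \<le> R\<rbrakk> \<Longrightarrow> x m \<notin> C"
  shows "\<forall>\<^sub>F k in sequentially. \<forall>w. near_orbit p q a R k w \<longrightarrow> w m \<notin> C"
proof (rule ccontr)
  assume "\<not> ?thesis"
  then have "\<exists>w. near_orbit p q a R k w \<and> w m \<in> C" for k
    unfolding eventually_sequentially using near_orbit_antimono by blast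
  then obtain \<omega> where \<omega>: "\<And>k. near_orbit p q a R k (\<omega> k)" "\<And>k. \<omega> k m \<in> C"
    by metis
  then obtain t x where t: "strict_mono (t :: nat \<Rightarrow> nat)" and x: "\<And>i. (\<lambda>k. \<omega> (t k) i) \<longlonglongrightarrow> x i"
      and orb: "forward_orbit p q a x" "\<And>i. norm (x i) \<le> R"
    using pseudo_orbits_limit [of p q a \<omega> R] unfolding near_orbit_def by metis
  have "(\<lambda>k. 1 / real (Suc (t k))) \<longlonglongrightarrow> 0"
    using LIMSEQ_subseq_LIMSEQ [OF lim_inverse_n' [THEN LIMSEQ_Suc] t] by (simp add: o_def)
  then have "(\<lambda>k. \<omega> (t k) 0) \<longlonglongrightarrow> 0"
    by (rule Lim_null_comparison [rotated]) (use \<omega>(1) in \<open>auto simp: near_orbit_def\<close>)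
  then have "x 0 = 0"
    using x LIMSEQ_unique by blast
  moreover have "x m \<in> C"
    using closed_sequentially [OF C _ x] \<omega>(2) by blast
  ultimately show False
    using no orb by blast
qed

section \<open>Returns to a neighbourhood of the critical point\<close>

text \<open>
  Pseudo-orbits from near \<open>0\<close> follow the only bounded orbit \<open>z\<close> of \<open>0\<close>, by compactness.
  The first step is contracting of order \<open>p/q > 1\<close> in the distance of the starting point from
  \<open>0\<close>. As long as \<open>z\<^sub>i \<noteq> 0\<close>, each further step is Lipschitz near the orbit: this is
  \<open>root_step_lipschitz\<close> with the roles of \<open>p\<close> and \<open>q\<close>, of source and target, exchanged.
\<close>

lemma orbit_tracking:
  assumes p: "1 \<le> p" and q: "1 \<le> q"
    and z: "forward_orbit p q a z" "z 0 = 0"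
    and unique: "\<And>x. \<lbrakk>forward_orbit p q a x; x 0 = 0; \<And>i. norm (x i) \<le> R\<rbrakk> \<Longrightarrow> x = z"
    and nz: "\<And>i. \<lbrakk>0 < i; i < n\<rbrakk> \<Longrightarrow> z i \<noteq> 0"
    and i: "1 \<le> i" "i \<le> n"
  shows "\<exists>L\<ge>0. \<forall>\<^sub>F k in sequentially. \<forall>w r. near_orbit p q a R k w \<longrightarrow> 0 \<le> r \<longrightarrow> r \<le> 1 / Suc k \<longrightarrow>
      pseudo_orbit p q a r k w \<longrightarrow> norm (w i - z i) \<le> L * (norm (w 0) powr (real p / real q) + r)"
  using i
proof (induction i rule: nat_induct_at_least)
  case base
  have z1: "z 1 = a"
  proof -
    have "(z (Suc 0) - a) ^ q = z 0 ^ p"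
      using z(1) by (simp add: forward_orbit_def corr_def)
    then have "(z 1 - a) ^ q = 0"
      using z(2) p by (simp add: power_0_left)
    then show ?thesis by simp
  qed
  have "norm (w 1 - z 1) \<le> norm (w 0) powr (real p / real q) + r"
    if orb: "pseudo_orbit p q a r k w" and k: "1 \<le> k" for w r k
  proof -
    obtain c where c: "dist a c \<le> r" "(w 1 - c) ^ q = w 0 ^ p"
      using orb k unfolding pseudo_orbit_def by (auto simp: Suc_le_eq)
    have "norm (w 1 - c) = norm (w 0) powr (real p / real q)"
    proof (cases "w 0 = 0")
      case True
      then show ?thesis
        using c(2) p by (simp add: power_0_left)
    next
      case False
      then show ?thesis
        by (rule norm_of_root [OF q c(2)])
    qed
    then show ?thesis
      using norm_triangle_ineq [of "w 1 - c" "c - a"] c(1) unfolding z1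
      by (simp add: dist_norm norm_minus_commute)
  qed
  then have "\<forall>\<^sub>F k in sequentially. \<forall>w r. near_orbit p q a R k w \<longrightarrow> 0 \<le> r \<longrightarrow> r \<le> 1 / Suc k \<longrightarrow>
      pseudo_orbit p q a r k w \<longrightarrow> norm (w 1 - z 1) \<le> 1 * (norm (w 0) powr (real p / real q) + r)"
    by (intro eventually_mono [OF eventually_ge_at_top [of 1]]) auto
  then show ?case
    by (meson zero_le_one)
next
  case (Suc i)
  then obtain L where L: "0 \<le> L" "\<forall>\<^sub>F k in sequentially. \<forall>w r. near_orbit p q a R k w \<longrightarrow> 0 \<le> r \<longrightarrow> r \<le> 1 / Suc k \<longrightarrow>
      pseudo_orbit p q a r k w \<longrightarrow> norm (w i - z i) \<le> L * (norm (w 0) powr (real p / real q) + r)"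
    by auto
  have zi: "z i \<noteq> 0"
    using Suc nz by auto
  have rel: "(z (Suc i) - a) ^ q = z i ^ p"
    using z by (simp add: forward_orbit_def corr_def)
  have bi: "z (Suc i) - a \<noteq> 0"
    using rel zi q by (metis power_not_zero power_0_left not_one_le_zero)
  define F where "F = norm (step_factor q p 0 (z (Suc i) - a) (z i))"
  have F: "0 < F"
    using zi bi p q by (simp add: F_def step_factor_def)
  obtain s where s: "0 < s" "\<And>c A B \<alpha> \<beta>. \<lbrakk>dist c 0 < s; dist A (z i) < s; dist B (z i) < s;
        dist \<alpha> (z (Suc i) - a) < s; dist \<beta> (z (Suc i) - a) < s; (A - c) ^ p = \<alpha> ^ q; (B - c) ^ p = \<beta> ^ q\<rbrakk>
        \<Longrightarrow> dist \<alpha> \<beta> * F \<le> 2 * dist A B"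
    using root_step_lipschitz [of q p "z i" 0 "z (Suc i) - a" 2] p q rel bi unfolding F_def by auto
  have close: "\<forall>\<^sub>F k in sequentially. \<forall>w. near_orbit p q a R k w \<longrightarrow> w j \<notin> - ball (z j) (s/2)" for j
    by (rule eventually_near_orbit_avoids) (use unique s(1) in auto)
  have small: "\<forall>\<^sub>F k in sequentially. 1 / real (Suc k) < s/2"
    using s(1) by (intro order_tendstoD(2) [OF lim_inverse_n' [THEN LIMSEQ_Suc]]) auto
  define L' where "L' = 2 / F * L + 1"
  have "\<forall>\<^sub>F k in sequentially. \<forall>w r. near_orbit p q a R k w \<longrightarrow> 0 \<le> r \<longrightarrow> r \<le> 1 / Suc k \<longrightarrow>
      pseudo_orbit p q a r k w \<longrightarrow> norm (w (Suc i) - z (Suc i)) \<le> L' * (norm (w 0) powr (real p / real q) + r)"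
    using L(2) close [of i] close [of "Suc i"] small eventually_gt_at_top [of i]
  proof eventually_elim
    case (elim k)
    show ?case
    proof (intro allI impI)
      fix w r
      assume w: "near_orbit p q a R k w" and r: "0 \<le> r" "r \<le> 1 / Suc k" and orb: "pseudo_orbit p q a r k w"
      define e where "e = norm (w 0) powr (real p / real q)"
      obtain c where c: "dist a c \<le> r" "(w (Suc i) - c) ^ q = w i ^ p"
        using orb elim(5) unfolding pseudo_orbit_def by (metis mem_cball)
      have near: "dist (w i) (z i) < s/2" "dist (w (Suc i)) (z (Suc i)) < s/2"
        using elim(2,3) w by (auto simp: dist_commute)
      have ca: "norm (c - a) \<le> r"
        using c(1) by (simp add: dist_norm norm_minus_commute)
      have "norm ((w (Suc i) - c) - (z (Suc i) - a)) \<le> norm (w (Suc i) - z (Suc i)) + norm (c - a)"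
        using norm_triangle_ineq4 [of "w (Suc i) - z (Suc i)" "c - a"] by (simp add: algebra_simps)
      also have "\<dots> < s"
        using near(2) ca r(2) elim(4) unfolding dist_norm by linarith
      finally have "dist (w (Suc i) - c) (z (Suc i) - a) * F \<le> 2 * dist (w i) (z i)"
        using near(1) s(1) c(2) rel by (intro s(2) [of 0]) (auto simp: dist_norm)
      also have "\<dots> \<le> 2 * (L * (e + r))"
        using elim(1) w r orb by (simp add: dist_norm e_def)
      finally have "norm ((w (Suc i) - c) - (z (Suc i) - a)) \<le> 2 / F * L * (e + r)"
        using F by (simp add: dist_norm field_simps)
      moreover have "norm (w (Suc i) - z (Suc i)) \<le> norm ((w (Suc i) - c) - (z (Suc i) - a)) + norm (c - a)"
        using norm_triangle_ineq [of "(w (Suc i) - c) - (z (Suc i) - a)" "c - a"] by simp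
      moreover have "L' * (e + r) = 2 / F * L * (e + r) + (e + r)"
        by (simp add: L'_def ring_distribs)
      moreover have "0 \<le> e"
        by (simp add: e_def)
      ultimately show "norm (w (Suc i) - z (Suc i)) \<le> L' * (norm (w 0) powr (real p / real q) + r)"
        using ca unfolding e_def [symmetric] by linarith
    qed
  qed
  moreover have "0 \<le> L'"
    using F L(1) by (simp add: L'_def)
  ultimately show ?case
    by blast
qed

text \<open>
  Outside \<open>M\<^bsub>\<beta>,0\<^esub>\<close> there are eventually no near orbits at all, and \<open>L = 0\<close> works. At a simple
  centre \<open>n\<close> is the time of the first return of \<open>0\<close> to itself, which guarantees \<open>z\<^sub>i \<noteq> 0\<close> for
  \<open>0 < i < n\<close>.
\<close>

lemma eventually_return_estimate:
  assumes p: "1 \<le> p" and q: "1 \<le> q" and a: "a \<notin> M_set p q \<or> simple_centre p q a"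
  shows "\<exists>n\<ge>1. \<exists>L\<ge>0. \<forall>\<^sub>F k in sequentially. \<forall>w r. near_orbit p q a R k w \<longrightarrow> 0 \<le> r \<longrightarrow> r \<le> 1 / Suc k \<longrightarrow>
      pseudo_orbit p q a r k w \<longrightarrow> norm (w n) \<le> L * (norm (w 0) powr (real p / real q) + r)"
  using a
proof
  assume "a \<notin> M_set p q"
  then have "\<forall>\<^sub>F k in sequentially. \<forall>w. near_orbit p q a R k w \<longrightarrow> w 0 \<notin> UNIV"
    by (intro eventually_near_orbit_avoids)
      (auto simp: M_set_def filled_julia_def bounded_forward_orbit_from_def bounded_iff)
  then show ?thesis
    by (intro exI [of _ 1] conjI exI [of _ 0]) (auto elim!: eventually_mono)
next
  assume "simple_centre p q a"
  then obtain z where z: "bounded_forward_orbit_from p q a 0 z" "is_cycle p q a z"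
      and unique: "\<And>x. bounded_forward_orbit_from p q a 0 x \<Longrightarrow> x = z"
    unfolding simple_centre_def by metis
  have z0: "z 0 = 0" "forward_orbit p q a z"
    using z(1) by (auto simp: bounded_forward_orbit_from_def)
  obtain m where "1 \<le> m" "z m = 0"
    using z(2) z0 unfolding is_cycle_def cycle_of_period_def by (metis add_0)
  then have ex: "\<exists>m. 1 \<le> m \<and> z m = 0"
    by blast
  define n where "n = (LEAST m. 1 \<le> m \<and> z m = 0)"
  have n: "1 \<le> n" "z n = 0"
    using LeastI_ex [OF ex] by (simp_all add: n_def)
  have nz: "z i \<noteq> 0" if "0 < i" "i < n" for i
    using that not_less_Least [of i "\<lambda>m. 1 \<le> m \<and> z m = 0"] by (auto simp: n_def Suc_le_eq)
  have "x = z" if "forward_orbit p q a x" "x 0 = 0" "\<And>i. norm (x i) \<le> R" for x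
    using that by (intro unique) (auto simp: bounded_forward_orbit_from_def bounded_iff)
  from orbit_tracking [OF p q z0(2,1) this nz n(1) order_refl]
  show ?thesis
    using n by auto
qed

text \<open>
  Since \<open>L \<delta>\<^sup>\<beta>\<close> with \<open>\<beta> = p/q > 1\<close> is small compared to \<open>\<delta>\<close>, the return estimate maps the
  disc of radius \<open>\<delta>\<close> into itself, once the error \<open>r\<close> is small compared to \<open>\<delta>\<close>. The product in the
  conclusion bounds the derivative along such a return: its first factor comes from the point in the small
  disc, the other \<open>n - 1\<close> factors from points in the disc of radius \<open>R\<close>.
\<close>

lemma return_radius:
  assumes q: "1 \<le> q" "q < p" and a: "a \<notin> M_set p q \<or> simple_centre p q a"
    and \<delta>1: "0 < \<delta>1" and R: "0 \<le> R"
  obtains \<delta> n N r where "0 < \<delta>" "\<delta> \<le> \<delta>1" "1 \<le> n" "n \<le> N" "0 < r" "r \<le> 1"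
    "real p / real q * \<delta> powr (real p / real q - 1) * (real p / real q * R powr (real p / real q - 1)) ^ (n - 1) \<le> 1"
    "\<And>w. \<lbrakk>pseudo_orbit p q a r N w; norm (w 0) \<le> \<delta>; \<And>i. i \<le> N \<Longrightarrow> norm (w i) \<le> R\<rbrakk> \<Longrightarrow> norm (w n) \<le> \<delta>"
proof -
  define \<beta> where "\<beta> = real p / real q"
  have \<beta>: "1 < \<beta>"
    using q by (simp add: \<beta>_def)
  obtain n L where n: "1 \<le> n" and L: "0 \<le> L"
    and ev: "\<forall>\<^sub>F k in sequentially. \<forall>w r. near_orbit p q a R k w \<longrightarrow> 0 \<le> r \<longrightarrow> r \<le> 1 / Suc k \<longrightarrow>
      pseudo_orbit p q a r k w \<longrightarrow> norm (w n) \<le> L * (norm (w 0) powr \<beta> + r)"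
    using eventually_return_estimate [OF _ q(1) a, of R] q unfolding \<beta>_def by auto
  obtain k where k: "n \<le> k" and track: "\<And>w r. \<lbrakk>near_orbit p q a R k w; 0 \<le> r; r \<le> 1 / Suc k;
      pseudo_orbit p q a r k w\<rbrakk> \<Longrightarrow> norm (w n) \<le> L * (norm (w 0) powr \<beta> + r)"
    using eventually_happens' [OF trivial_limit_sequentially eventually_conj [OF ev eventually_ge_at_top [of n]]]
    by auto
  define C where "C = (\<beta> * R powr (\<beta> - 1)) ^ (n - 1)"
  have tend: "((\<lambda>\<delta>::real. K * \<delta> powr (\<beta> - 1)) \<longlongrightarrow> K * 0) (at_right 0)" for K
    using \<beta> by (intro tendsto_mult_left tendsto_zero_powrI [where b = "\<beta> - 1"])
      (auto intro: tendsto_ident_at simp: eventually_at_right_less eventually_at_filter)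
  have "\<forall>\<^sub>F \<delta> in at_right (0::real). 0 < \<delta> \<and> \<delta> < \<delta>1 \<and> \<delta> < 1 / Suc k \<and>
      \<beta> * C * \<delta> powr (\<beta> - 1) < 1 \<and> L * \<delta> powr (\<beta> - 1) < 1/2"
    by (intro eventually_conj order_tendstoD(2) [OF tend] eventually_at_right_less
        order_tendstoD(2) [OF tendsto_ident_at]) (use \<delta>1 in auto)
  then obtain \<delta> where \<delta>: "0 < \<delta>" "\<delta> < \<delta>1" "\<delta> < 1 / Suc k" "\<beta> * C * \<delta> powr (\<beta> - 1) < 1" "L * \<delta> powr (\<beta> - 1) < 1/2"
    using eventually_happens' [OF trivial_limit_at_right_real] by blast
  define r where "r = min (1 / Suc k) (\<delta> / (2 * (L + 1)))"
  have r: "0 < r" "r \<le> 1 / Suc k" "r \<le> 1"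
    using \<delta>(1) L by (auto simp: r_def min_le_iff_disj)
  have Lr: "L * r \<le> \<delta> / 2"
  proof -
    have "L * r \<le> L * (\<delta> / (2 * (L + 1)))"
      using L by (intro mult_left_mono) (auto simp: r_def)
    also have "\<dots> \<le> \<delta> / 2"
      using L \<delta>(1) by (simp add: field_simps)
    finally show ?thesis .
  qed
  have "norm (w n) \<le> \<delta>"
    if w: "pseudo_orbit p q a r k w" "norm (w 0) \<le> \<delta>" "\<And>i. i \<le> k \<Longrightarrow> norm (w i) \<le> R" for w
  proof -
    have "near_orbit p q a R k w"
      using w \<delta>(3) pseudo_orbit_mono [OF w(1) r(2) order_refl] by (auto simp: near_orbit_def)
    then have "norm (w n) \<le> L * (norm (w 0) powr \<beta> + r)"
      using track r w(1) by simp
    also have "\<dots> \<le> L * (\<delta> powr \<beta> + r)"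
      using w(2) L \<beta> by (intro mult_left_mono add_right_mono powr_mono2) auto
    also have "\<dots> = L * \<delta> powr (\<beta> - 1) * \<delta> + L * r"
      using \<delta>(1) by (simp add: powr_diff ring_distribs)
    also have "\<dots> \<le> 1/2 * \<delta> + L * r"
      using \<delta> by (intro add_right_mono mult_right_mono) auto
    also have "\<dots> \<le> \<delta>"
      using Lr by simp
    finally show ?thesis .
  qed
  then show ?thesis
    using that [of \<delta> n k r] \<delta> n k r unfolding \<beta>_def [symmetric] by (simp add: C_def mult_ac)
qed

section \<open>A trap near a good parameter\<close>

lemma prod_lessThan_add:
  fixes f :: "nat \<Rightarrow> 'a::comm_monoid_mult"
  shows "(\<Prod>j<m + n. f j) = (\<Prod>j<m. f j) * (\<Prod>j<n. f (m + j))"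
  by (induction n) (auto simp: mult.assoc)

lemma prod_blocks:
  fixes f :: "nat \<Rightarrow> 'a::comm_monoid_mult"
  shows "(\<Prod>j<k * n. f j) = (\<Prod>l<k. \<Prod>j<n. f (l * n + j))"
proof (induction k)
  case (Suc k)
  then show ?case
    using prod_lessThan_add [of f "k * n" n] by (simp add: add.commute [of n])
qed simp

text \<open>
  A cycle of period \<open>m\<close> with a point in the small disc is in that disc at all multiples of \<open>n\<close>. Its
  \<open>mn\<close> consecutive derivatives have modulus \<open>|\<mu>|\<^sup>n\<close> when grouped by periods, where \<open>\<mu>\<close> is the
  multiplier, and at most \<open>1\<close> when grouped by returns.
\<close>

lemma repelling_cycle_avoids_disc:
  assumes q: "1 \<le> q" "q < p" and n: "1 \<le> n" and \<delta>: "0 < \<delta>"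
    and contr: "real p / real q * \<delta> powr (real p / real q - 1) *
      (real p / real q * R powr (real p / real q - 1)) ^ (n - 1) \<le> 1"
    and return: "\<And>w. \<lbrakk>forward_orbit p q c w; norm (w 0) \<le> \<delta>; \<And>i. norm (w i) \<le> R\<rbrakk> \<Longrightarrow> norm (w n) \<le> \<delta>"
    and z: "repelling_cycle p q c z" "\<And>i. norm (z i) \<le> R"
  shows "\<delta> < norm (z i)"
proof (rule ccontr)
  assume "\<not> ?thesis"
  then have zi: "norm (z i) \<le> \<delta>"
    by simp
  define \<beta> where "\<beta> = real p / real q"
  have \<beta>: "1 < \<beta>"
    using q by (simp add: \<beta>_def)
  define h where "h x = \<beta> * norm x powr (\<beta> - 1)" for x :: complex
  have h_nonneg: "0 \<le> h x" for x
    using \<beta> by (simp add: h_def)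
  have "0 \<notin> range z"
    using z(1) by (auto simp: repelling_cycle_def)
  then obtain m where m: "cycle_of_period p q c m z" "1 < (\<Prod>j<m. h (z j))"
    using z(1) repelling_cycle_iff [of q p z c] q by (auto simp: h_def \<beta>_def)
  have orb: "forward_orbit p q c z" and per: "z (j + m) = z j" for j
    using m(1) by (auto simp: cycle_of_period_def)
  define w where "w j = z (i + j)" for j
  have w_orb: "forward_orbit p q c (\<lambda>j. w (l + j))" for l
    using forward_orbit_shift [OF orb, of "i + l"] by (simp add: w_def add.assoc)
  have w_per: "w (j + m) = w j" for j
    using per [of "i + j"] by (simp add: w_def add.assoc)
  have returns: "norm (w (l * n)) \<le> \<delta>" for l
  proof (induction l)
    case 0
    show ?case using zi by (simp add: w_def)
  next
    case (Suc l)
    then show ?case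
      using return [OF w_orb [of "l * n"]] z(2) by (simp add: w_def add.commute)
  qed
  have block: "(\<Prod>j<n. h (w (l * n + j))) \<le> 1" for l
  proof -
    have "(\<Prod>j<n. h (w (l * n + j))) = h (w (l * n)) * (\<Prod>j<n - 1. h (w (l * n + Suc j)))"
      using n by (cases n) (simp_all add: prod.lessThan_Suc_shift del: prod.lessThan_Suc)
    also have "\<dots> \<le> \<beta> * \<delta> powr (\<beta> - 1) * (\<Prod>j<n - 1. \<beta> * R powr (\<beta> - 1))"
    proof (intro mult_mono prod_mono conjI h_nonneg prod_nonneg ballI)
      show "h (w (l * n)) \<le> \<beta> * \<delta> powr (\<beta> - 1)"
        using returns \<beta> by (auto simp: h_def intro!: mult_left_mono powr_mono2)
      show "h (w (l * n + Suc j)) \<le> \<beta> * R powr (\<beta> - 1)" for j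
        using z(2) \<beta> by (auto simp: h_def w_def intro!: mult_left_mono powr_mono2)
    qed (use \<beta> in auto)
    finally show ?thesis
      using contr by (simp add: \<beta>_def)
  qed
  have "(\<Prod>j<m. h (w j)) ^ n = (\<Prod>l<n. \<Prod>j<m. h (w (l * m + j)))"
    using periodic_add_mult [of w m, OF w_per] by (simp add: add.commute)
  also have "\<dots> = (\<Prod>l<m. \<Prod>j<n. h (w (l * n + j)))"
    using prod_blocks [of "\<lambda>i. h (w i)" n m] prod_blocks [of "\<lambda>i. h (w i)" m n] by (simp add: mult.commute)
  also have "\<dots> \<le> 1"
    by (rule prod_le_1) (simp add: block prod_nonneg h_nonneg)
  finally have "(\<Prod>j<m. h (w j)) ^ n \<le> 1" .
  moreover have "(\<Prod>j<m. h (w j)) = (\<Prod>j<m. h (z j))"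
    using prod_periodic_shift [of "\<lambda>j. h (z j)" m i] per by (simp add: w_def)
  moreover have "1 < (\<Prod>j<m. h (z j)) ^ n"
    using m(2) n by (intro one_less_power) auto
  ultimately show False
    by simp
qed

text \<open>
  Such a fixed point lies outside a small enough disc about \<open>0\<close>, hence in the trap, where it is
  repelling. It shows that Julia sets are nonempty.
\<close>

lemma exists_nonzero_fixed_point:
  assumes q: "1 \<le> q" "q < p"
  shows "\<exists>\<zeta>::complex. \<zeta> \<noteq> 0 \<and> (\<zeta> - a) ^ q = \<zeta> ^ p"
proof (cases "a = 0")
  case True
  then show ?thesis
    by (intro exI [of _ 1]) simp
next
  case False
  define P where "P = monom 1 p - [:-a, 1:] ^ q"
  have "degree P = degree (monom (1::complex) p)"
    using q degree_linear_power [of "-a" q] unfolding P_def diff_conv_add_uminus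
    by (intro degree_add_eq_left) (auto simp: degree_monom_eq)
  then have "0 < degree P"
    using q by (simp add: degree_monom_eq)
  then obtain \<zeta> where "poly P \<zeta> = 0"
    using alg_closed_imp_poly_has_root by blast
  then have \<zeta>: "(\<zeta> - a) ^ q = \<zeta> ^ p"
    by (simp add: P_def poly_monom poly_power)
  then have "\<zeta> \<noteq> 0"
    using False q by (auto simp: power_0_left)
  then show ?thesis
    using \<zeta> by blast
qed

text \<open>
  The trap consists of the starting points of pseudo-orbits of length \<open>N\<close> in the annulus
  \<open>\<delta> < |w| < R\<close>, with errors up to \<open>r\<close>; the parameters are those at distance less than
  \<open>r/2\<close> from \<open>a\<close>. Let \<open>z\<close> be a preimage of a point \<open>v\<close> of the trap, and \<open>z'\<close> a point close to \<open>z\<close>.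
  Moving \<open>z\<close> to \<open>z'\<close> costs another \<open>r/2\<close> of error, so \<open>z'\<close> followed by the pseudo-orbit of \<open>v\<close>
  is a pseudo-orbit. It remains below \<open>R\<close> by the escape estimate. It does not start in the small
  disc, since then it would be there again at time \<open>n\<close>, which is a point of the pseudo-orbit of \<open>v\<close>.
\<close>

lemma exists_backward_trap:
  assumes q: "1 \<le> q" "q < p" and a: "a \<notin> M_set p q \<or> simple_centre p q a"
  obtains U \<Omega> \<epsilon> where "backward_trap p q U \<Omega> \<epsilon>" "a \<in> U"
    "\<And>c z. \<lbrakk>c \<in> U; repelling_cycle p q c z\<rbrakk> \<Longrightarrow> range z \<subseteq> \<Omega>" "\<exists>z. repelling_cycle p q a z"
proof -
  define R where "R = escape_radius q a"
  have R: "0 \<le> R"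
    by (simp add: R_def escape_radius_def)
  obtain \<zeta> :: complex where \<zeta>: "\<zeta> \<noteq> 0" "(\<zeta> - a) ^ q = \<zeta> ^ p"
    using exists_nonzero_fixed_point [OF q] by blast
  obtain \<delta> n N r where \<delta>: "0 < \<delta>" "\<delta> \<le> norm \<zeta> / 2" and n: "1 \<le> n" "n \<le> N" and r: "0 < r" "r \<le> 1"
    and contr: "real p / real q * \<delta> powr (real p / real q - 1) *
      (real p / real q * R powr (real p / real q - 1)) ^ (n - 1) \<le> 1"
    and return: "\<And>w. \<lbrakk>pseudo_orbit p q a r N w; norm (w 0) \<le> \<delta>; \<And>i. i \<le> N \<Longrightarrow> norm (w i) \<le> R\<rbrakk>
      \<Longrightarrow> norm (w n) \<le> \<delta>"
    using return_radius [OF q a _ R, of "norm \<zeta> / 2"] \<zeta>(1) by (metis half_gt_zero zero_less_norm_iff)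
  define U where "U = ball a (r/2)"
  define \<Omega> where "\<Omega> = {w 0 | w. pseudo_orbit p q a r N w \<and> (\<forall>i\<le>N. \<delta> < norm (w i) \<and> norm (w i) < R)}"
  obtain \<epsilon> where \<epsilon>: "0 < \<epsilon>" "\<epsilon> \<le> 1"
    "\<And>\<alpha> z z' :: complex. \<lbrakk>norm z \<le> R; dist z z' < \<epsilon>; \<alpha> ^ q = z ^ p\<rbrakk>
      \<Longrightarrow> \<exists>\<alpha>'. \<alpha>' ^ q = z' ^ p \<and> dist \<alpha> \<alpha>' < r/2"
    using exists_near_root_uniform [OF q(1), of "r/2" R p] r by auto
  have U1: "c \<in> cball a 1" "c \<in> cball a r" if "c \<in> U" for c
    using that r by (auto simp: U_def)
  have trap: "backward_trap p q U \<Omega> \<epsilon>"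
  proof
    show "bounded \<Omega>"
      by (rule bounded_subset [OF bounded_ball [of 0 R]]) (auto simp: \<Omega>_def)
    show "0 \<notin> \<Omega>"
      using \<delta>(1) by (auto simp: \<Omega>_def)
    fix c v z assume c: "c \<in> U" and v: "v \<in> \<Omega>" and rel: "(v - c) ^ q = z ^ p"
    obtain w where w: "w 0 = v" "pseudo_orbit p q a r N w" "\<And>i. i \<le> N \<Longrightarrow> \<delta> < norm (w i) \<and> norm (w i) < R"
      using v by (auto simp: \<Omega>_def)
    have z: "norm z < R - 1"
    proof (rule ccontr)
      assume "\<not> ?thesis"
      then have "norm z + 1 \<le> norm v"
        using escape_step [OF q U1(1) [OF c] rel] by (simp add: R_def)
      then show False
        using w(1,3) \<open>\<not> norm z < R - 1\<close> by fastforce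
    qed
    show "ball z \<epsilon> \<subseteq> \<Omega>"
    proof
      fix z' assume z': "z' \<in> ball z \<epsilon>"
      define w' where "w' = case_nat z' w"
      obtain \<alpha>' where \<alpha>': "\<alpha>' ^ q = z' ^ p" "dist (v - c) \<alpha>' < r/2"
        using \<epsilon>(3) [of z z' "v - c"] z z' rel by auto
      have "c - (v - \<alpha>') = - ((v - c) - \<alpha>')"
        by simp
      then have "dist c (v - \<alpha>') = dist (v - c) \<alpha>'"
        unfolding dist_norm by (metis norm_minus_cancel)
      then have "dist a (v - \<alpha>') \<le> dist a c + dist (v - c) \<alpha>'"
        using dist_triangle [of a "v - \<alpha>'" c] by simp
      then have "v - \<alpha>' \<in> cball a r"
        using c \<alpha>'(2) by (simp add: U_def)
      moreover have "(w' (Suc 0) - (v - \<alpha>')) ^ q = w' 0 ^ p"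
        using \<alpha>'(1) w(1) by (simp add: w'_def)
      ultimately have orb: "pseudo_orbit p q a r N w'"
        using w(2) unfolding pseudo_orbit_def w'_def by (auto split: nat.split)
      have "norm z' < R"
        using z z' \<epsilon>(2) norm_triangle_ineq2 [of z' z] by (simp add: dist_norm norm_minus_commute)
      then have "norm (w' i) < R" if "i \<le> N" for i
        using that w(3) by (auto simp: w'_def split: nat.split)
      moreover have "\<delta> < norm z'"
      proof (rule ccontr)
        assume "\<not> ?thesis"
        then have "norm (w' n) \<le> \<delta>"
          using return [OF orb] calculation by (force simp: w'_def intro: less_imp_le)
        then show False
          using w(3) [of "n - 1"] n by (cases n) (auto simp: w'_def)
      qed
      then have "\<delta> < norm (w' i)" if "i \<le> N" for i
        using that w(3) by (auto simp: w'_def split: nat.split)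
      ultimately show "z' \<in> \<Omega>"
        using orb unfolding \<Omega>_def by (intro CollectI exI [of _ w']) (auto simp: w'_def)
    qed
  qed (use q \<epsilon> in \<open>auto simp: U_def\<close>)
  have inside: "range z \<subseteq> \<Omega>"
    if "c \<in> U" "forward_orbit p q c z" "\<And>i. \<delta> < norm (z i)" "\<And>i. norm (z i) < R" for c z
  proof
    fix v assume "v \<in> range z"
    then obtain i where "v = z i"
      by auto
    then show "v \<in> \<Omega>"
      using that(3,4) forward_orbit_imp_pseudo_orbit [OF forward_orbit_shift [OF that(2)] U1(2) [OF that(1)]]
      unfolding \<Omega>_def by (intro CollectI exI [of _ "\<lambda>j. z (i + j)"]) auto
  qed
  have aU: "a \<in> U"
    using r by (simp add: U_def)
  have "range z \<subseteq> \<Omega>" if c: "c \<in> U" and z: "repelling_cycle p q c z" for c z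
  proof (rule inside [OF c])
    show orb: "forward_orbit p q c z"
      using z by (auto simp: repelling_cycle_def cycle_of_period_def)
    obtain m where m: "1 \<le> m" "\<And>i. z (i + m) = z i"
      using z by (auto simp: repelling_cycle_def cycle_of_period_def)
    have "z i \<in> z ` {..<m}" for i
    proof (rule image_eqI)
      show "z i = z (i mod m)"
        using periodic_add_mult [of z m "i mod m" "i div m", OF m(2)] by simp
    qed (use m(1) in auto)
    then have "bounded (range z)"
      by (intro bounded_subset [OF finite_imp_bounded [of "z ` {..<m}"]]) auto
    then show zR: "norm (z i) < R" for i
      using bounded_orbit_in_disc [OF q U1(1) [OF c] orb, of i] unfolding R_def by linarith
    show "\<delta> < norm (z i)" for i
      by (rule repelling_cycle_avoids_disc [OF q n(1) \<delta>(1) contr _ z])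
        (use return forward_orbit_imp_pseudo_orbit [OF _ U1(2) [OF c]] zR in \<open>auto intro: less_imp_le\<close>)
  qed
  moreover have "repelling_cycle p q a (\<lambda>_. \<zeta>)"
  proof -
    have cyc: "cycle_of_period p q a 1 (\<lambda>_. \<zeta>)"
      using \<zeta> by (simp add: cycle_of_period_def forward_orbit_def corr_def)
    then have orb: "forward_orbit p q a (\<lambda>_. \<zeta>)"
      by (simp add: cycle_of_period_def)
    have "norm \<zeta> < R"
      using bounded_orbit_in_disc [OF q _ orb, where a = a] by (simp add: R_def)
    then have "range (\<lambda>_::nat. \<zeta>) \<subseteq> \<Omega>"
      using \<delta> by (intro inside [OF aU orb]) auto
    then show ?thesis
      using backward_trap.cycle_repelling [OF trap aU cyc] by blast
  qed
  ultimately show ?thesis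
    using that [OF trap aU] by blast
qed

section \<open>The motion of the Julia set\<close>

context backward_trap
begin

text \<open>
  The family \<open>F\<close> of all holomorphic selections of \<open>c \<mapsto> J\<^sub>c\<close> over \<open>U\<close> is closed under
  locally uniform limits because every \<open>J\<^sub>c\<close> is closed. Continued cycles belong to it, so its graphs pass through all
  repelling periodic points, and by normality through all points of their closure.
\<close>

lemma julia_branched_motion:
  assumes inside: "\<And>c z. \<lbrakk>c \<in> U; repelling_cycle p q c z\<rbrakk> \<Longrightarrow> range z \<subseteq> \<Omega>"
    and nonempty: "c0 \<in> U" "repelling_cycle p q c0 z0" and b: "b \<in> U"
  shows "\<exists>h. normal_branched_holomorphic_motion U (julia p q b) b h \<and>
    (\<forall>c\<in>U. (\<Union>z\<in>julia p q b. h c z) = julia p q c)"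
proof -
  define F where "F = {f. f holomorphic_on U \<and> (\<forall>c\<in>U. f c \<in> julia p q c)}"
  have rep_julia: "range z \<subseteq> julia p q c" if "repelling_cycle p q c z" for c z
  proof -
    have "range z \<subseteq> (\<Union>z\<in>{z. repelling_cycle p q c z}. range z)"
      using that by (intro UN_upper) simp
    then show ?thesis
      unfolding julia_def using closure_subset by (rule order_trans)
  qed
  have "bounded (closure \<Omega>)"
    using bounded_\<Omega> by (rule bounded_closure)
  then obtain B where B: "\<And>w. w \<in> closure \<Omega> \<Longrightarrow> norm w \<le> B"
    by (auto simp: bounded_iff)
  have "julia p q c \<subseteq> closure \<Omega>" if "c \<in> U" for c
    unfolding julia_def using inside that by (intro closure_mono) blast
  then have F_bound: "norm (f c) \<le> B" if "f \<in> F" "c \<in> U" for f c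
    using that B by (auto simp: F_def)
  have montel: "\<exists>g r. g \<in> F \<and> strict_mono (r :: nat \<Rightarrow> nat) \<and> (\<forall>c\<in>U. (\<lambda>k. s (r k) c) \<longlonglongrightarrow> g c) \<and>
      (\<forall>K. compact K \<and> K \<subseteq> U \<longrightarrow> uniform_limit K (s \<circ> r) g sequentially)"
    if s: "range s \<subseteq> F" for s :: "nat \<Rightarrow> complex \<Rightarrow> complex"
  proof -
    obtain g r where g: "g holomorphic_on U" "strict_mono (r :: nat \<Rightarrow> nat)"
        "\<And>x. x \<in> U \<Longrightarrow> (\<lambda>k. s (r k) x) \<longlonglongrightarrow> g x"
        "\<And>K. \<lbrakk>compact K; K \<subseteq> U\<rbrakk> \<Longrightarrow> uniform_limit K (s \<circ> r) g sequentially"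
    proof (rule Montel [of U F s, OF open_U])
      show "h holomorphic_on U" if "h \<in> F" for h
        using that by (simp add: F_def)
      show "\<exists>B. \<forall>h\<in>F. \<forall>z\<in>K. norm (h z) \<le> B" if "compact K" "K \<subseteq> U" for K
        using F_bound that by blast
    qed (use s in auto)
    have "g c \<in> julia p q c" if "c \<in> U" for c
    proof (rule closed_sequentially [OF _ _ g(3) [OF that]])
      show "closed (julia p q c)"
        by (simp add: julia_def)
      show "s (r k) c \<in> julia p q c" for k
        using s that by (auto simp: F_def)
    qed
    then show ?thesis
      using g by (intro exI [of _ g] exI [of _ r]) (auto simp: F_def)
  qed
  have through_repelling: "\<exists>f\<in>F. f c = z i" if c: "c \<in> U" and z: "repelling_cycle p q c z" for c z i
  proof -
    obtain n where "cycle_of_period p q c n z"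
      using z by (auto simp: repelling_cycle_def)
    then have "cycle_of_period p q c n (\<lambda>j. z (i + j))"
      by (auto simp: cycle_of_period_def forward_orbit_shift simp flip: add.assoc)
    moreover have "range (\<lambda>j. z (i + j)) \<subseteq> \<Omega>"
      using inside [OF c z] by auto
    ultimately obtain f where f: "f holomorphic_on U" "f c = z (i + 0)"
        "\<And>c'. c' \<in> U \<Longrightarrow> \<exists>x. cycle_of_period p q c' n x \<and> range x \<subseteq> \<Omega> \<and> x 0 = f c'"
      using cycle_continuation [OF c] by metis
    have "f c' \<in> julia p q c'" if "c' \<in> U" for c'
      using f(3) [OF that] cycle_repelling [OF that] rep_julia by (metis range_subsetD)
    then show ?thesis
      using f by (auto simp: F_def)
  qed
  have through: "\<exists>f\<in>F. f c = z" if c: "c \<in> U" and z: "z \<in> julia p q c" for c z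
  proof -
    obtain v where v: "\<And>k::nat. v k \<in> (\<Union>z\<in>{z. repelling_cycle p q c z}. range z)" "v \<longlonglongrightarrow> z"
      using z unfolding julia_def closure_sequential by blast
    have "\<exists>f\<in>F. f c = v k" for k
      using v(1) [of k] through_repelling [OF c] by fastforce
    then obtain s where s: "\<And>k. s k \<in> F" "\<And>k. s k c = v k"
      by metis
    then obtain g r where g: "g \<in> F" "strict_mono (r :: nat \<Rightarrow> nat)" "(\<lambda>k. s (r k) c) \<longlonglongrightarrow> g c"
      using montel [of s] c by blast
    have "(\<lambda>k. v (r k)) \<longlonglongrightarrow> z"
      using LIMSEQ_subseq_LIMSEQ [OF v(2) g(2)] by (simp add: o_def)
    then have "g c = z"
      using g(3) s(2) LIMSEQ_unique by auto
    then show ?thesis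
      using g(1) by blast
  qed
  define h where "h c z = {f c | f. f \<in> F \<and> f b = z}" for c z
  have F_julia: "f c \<in> julia p q c" if "f \<in> F" "c \<in> U" for f c
    using that by (simp add: F_def)
  have "\<exists>f. f \<in> F"
    using through_repelling [OF nonempty] by blast
  then have ne: "julia p q b \<noteq> {}"
    using F_julia b by blast
  have union: "(\<Union>z\<in>julia p q b. h c z) = {f c | f. f \<in> F}" for c
    using F_julia b by (auto simp: h_def)
  have "(\<Union>z\<in>julia p q b. {(c, w). c \<in> U \<and> w \<in> h c z}) = (\<Union>f\<in>F. {(c, f c) | c. c \<in> U})"
    using F_julia b by (auto simp: h_def)
  moreover have "h c z \<noteq> {}" if "z \<in> julia p q b" for c z
    using through [OF b that] by (auto simp: h_def)
  moreover have "h b z = {z}" if "z \<in> julia p q b" for z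
    using through [OF b that] by (auto simp: h_def)
  ultimately have "branched_holomorphic_motion_via F U (julia p q b) b h"
    unfolding branched_holomorphic_motion_via_def using open_U b ne by (auto simp: F_def)
  moreover have "normal_family U F"
    unfolding normal_family_def
  proof (intro conjI ballI allI impI)
    fix s :: "nat \<Rightarrow> complex \<Rightarrow> complex"
    assume "range s \<subseteq> F"
    from montel [OF this] obtain g r where "g \<in> F" "strict_mono (r :: nat \<Rightarrow> nat)"
        "\<forall>K. compact K \<and> K \<subseteq> U \<longrightarrow> uniform_limit K (s \<circ> r) g sequentially"
      by blast
    then show "\<exists>g r. g holomorphic_on U \<and> strict_mono (r :: nat \<Rightarrow> nat) \<and>
        (\<forall>K. compact K \<and> K \<subseteq> U \<longrightarrow> uniform_limit K (s \<circ> r) g sequentially)"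
      by (intro exI [of _ g] exI [of _ r]) (auto simp: F_def)
  qed (auto simp: F_def)
  moreover have "(\<Union>z\<in>julia p q b. h c z) = julia p q c" if "c \<in> U" for c
    unfolding union using through [OF that] F_julia that by blast
  ultimately show ?thesis
    unfolding normal_branched_holomorphic_motion_def by blast
qed

end

theorem theorem1p4:
  fixes p q :: nat
  assumes "1 \<le> q" and "q < p"
  shows "\<exists>H N :: complex set.
    open H \<and> open N \<and> {c. simple_centre p q c} \<subseteq> N \<and> H = (UNIV - M_set p q) \<union> N \<and>
    (\<forall>c\<^sub>0\<in>H. \<exists>U h. open U \<and> c\<^sub>0 \<in> U \<and>
       normal_branched_holomorphic_motion U (julia p q c\<^sub>0) c\<^sub>0 h \<and>
       (\<forall>c\<in>U. (\<Union>z\<in>julia p q c\<^sub>0. h c z) = julia p q c))"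
proof -
  \<comment> \<open>Every point of a set in \<open>\<U>\<close> may serve as base point, so the union of these sets is itself a suitable
      neighbourhood; it contains the complement of \<open>M_set p q\<close> as well as the simple centres.\<close>
  define \<U> where "\<U> = {U. open U \<and> (\<forall>b\<in>U. \<exists>h. normal_branched_holomorphic_motion U (julia p q b) b h \<and>
    (\<forall>c\<in>U. (\<Union>z\<in>julia p q b. h c z) = julia p q c))}"
  have cover: "a \<in> \<Union>\<U>" if "a \<notin> M_set p q \<or> simple_centre p q a" for a
  proof -
    obtain U \<Omega> \<epsilon> z where U: "backward_trap p q U \<Omega> \<epsilon>" "a \<in> U"
      "\<And>c z. \<lbrakk>c \<in> U; repelling_cycle p q c z\<rbrakk> \<Longrightarrow> range z \<subseteq> \<Omega>" "repelling_cycle p q a z"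
      using exists_backward_trap [OF assms \<open>a \<notin> M_set p q \<or> simple_centre p q a\<close>] by metis
    have "U \<in> \<U>"
      using backward_trap.julia_branched_motion [OF U(1,3,2,4)] backward_trap.open_U [OF U(1)]
      by (auto simp: \<U>_def)
    then show ?thesis
      using U(2) by blast
  qed
  have "open (\<Union>\<U>)"
    by (auto simp: \<U>_def)
  moreover have "{c. simple_centre p q c} \<subseteq> \<Union>\<U>" "\<Union>\<U> = (UNIV - M_set p q) \<union> \<Union>\<U>"
    using cover by auto
  moreover have "\<forall>c\<^sub>0\<in>\<Union>\<U>. \<exists>U h. open U \<and> c\<^sub>0 \<in> U \<and>
       normal_branched_holomorphic_motion U (julia p q c\<^sub>0) c\<^sub>0 h \<and>
       (\<forall>c\<in>U. (\<Union>z\<in>julia p q c\<^sub>0. h c z) = julia p q c)"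
    by (auto simp: \<U>_def)
  ultimately show ?thesis
    by blast
qed

end
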